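(* For $\alpha>0$, $\rho\in(0,1)$ and $|\arg(z)|<\pi$ $$\phi(z;\alpha,\rho)=(2\pi\sqrt z)^{-\alpha\rho}\;\frac{G\left(\frac12+\frac\alpha2\left(1+\rho+\frac{\ln(z)}{\pi i}\right);\alpha\right)}{G\left(\frac12+\frac\alpha2\left(1-\rho+\frac{\ln(z)}{\pi i}\right);\alpha\right)}\times\frac{G\left(\frac12+\frac\alpha2\left(1+\rho-\frac{\ln(z)}{\pi i}\right);\alpha\right)}{G\left(\frac12+\frac\alpha2\left(1-\rho-\frac{\ln(z)}{\pi i}\right);\alpha\right)}.$$
   Context: $G(z;\tau)$ is the Barnes double gamma function: with $\psi=\Gamma'/\Gamma$, for $|\arg\tau|<\pi$, $$G(z;\tau)=\frac{1}{\tau\Gamma(z)}e^{\tilde a\frac z\tau+\tilde b\frac{z^2}{2\tau^2}}\prod_{m\ge1}\frac{\Gamma(m\tau)}{\Gamma(z+m\tau)}e^{z\psi(m\tau)+\frac{z^2}{2}\psi'(m\tau)},$$ $\tilde a=\frac\tau2\ln(2\pi\tau)+\frac12\ln(\tau)-\tau C(\tau)$, $\tilde b=-\tau\ln(\tau)-\tau^2D(\tau)$, where $C(\tau)=\lim_{m\to\infty}\left[\sum_{k=1}^{m-1}\psi(k\tau)+\frac12\psi(m\tau)-\frac1\tau\ln\left(\frac{\Gamma(m\tau)}{\sqrt{2\pi}}\right)\right]$ and $D(\tau)=\lim_{m\to\infty}\left[\sum_{k=1}^{m-1}\psi'(k\tau)+\frac12\psi'(m\tau)-\frac1\tau\psi(m\tau)\right]$.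 It is entire in $z$ and satisfies $G(1;\tau)=1$, $G(z+1;\tau)=\Gamma(z/\tau)G(z;\tau)$, $G(z+\tau;\tau)=(2\pi)^{(\tau-1)/2}\tau^{-z+1/2}\Gamma(z)G(z;\tau)$. Definition of $\phi$. The admissible set is $\mathcal A=\{\alpha\in(0,1),\rho\in(0,1)\}\cup\{\alpha=1,\rho=\frac12\}\cup\{\alpha\in(1,2),\rho\in[1-\alpha^{-1},\alpha^{-1}]\}$. For $(\alpha,\rho)\in\mathcal A$, let $X_t$ be the stable Lévy process with $X_0=0$, $\mathbb E[e^{izX_t}]=e^{-t\Psi(z)}$, $z\in\mathbb R$, $\Psi(z)=e^{\pi i\gamma/2}|z|^\alpha$ for $z>0$, $\Psi(z)=e^{-\pi i\gamma/2}|z|^\alpha$ for $z<0$, $\gamma=\alpha(1-2\rho)$; then $\phi(z;\alpha,\rho)=\mathbb E[e^{-zS_{e(1)}}]$ for $\mathrm{Re}(z)\ge0$, where $S_t=\sup_{0\le u\le t}X_u$ and $e(1)$ is an independent unit-mean exponential variable. For general $\alpha>0$, $\rho\in(0,1)$ the function is extended by analytic continuation in the parameters: for $z>0$, $$\phi(z;\alpha,\rho)=\exp\left(\int_0^z\frac{1}{2\pi iu}\left[F(\pi i\rho-\ln u;i/\alpha)-F(-\pi i\rho-\ln u;i/\alpha)\right]du\right),\quad F(w;i/\alpha)=\int_{\mathbb R}\frac{dx}{(1+e^{w-x/\alpha})(1+e^x)}\ (|\mathrm{Im}\,w|<\pi),$$ which agrees with the probabilistic definition when $(\alpha,\rho)\in\mathcal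 A$; for complex $z$ with $|\arg z|<\pi$, $\phi$ denotes the meromorphic continuation in $z$. Logarithms and powers are principal branches. *)

theory Defs
  imports "HOL-Complex_Analysis.Complex_Analysis"
begin

section \<open>The Barnes double gamma function\<close>

text \<open>
  The parameter \<open>\<tau>\<close> ranges over the plane cut along the nonpositive reals. For
  \<open>\<tau> > 0\<close>, \<^term>\<open>ln_Gamma (of_nat m * \<tau>)\<close> is the principal logarithm of
  \<^term>\<open>Gamma (of_nat m * \<tau>)\<close>; for complex \<open>\<tau>\<close> it is the analytic branch, which the
  existence of the limit requires. The derivative of \<^const>\<open>Digamma\<close> is
  \<^term>\<open>Polygamma 1\<close>.
\<close>

definition barnes_C :: "complex \<Rightarrow> complex" where
  "barnes_C \<tau> = lim (\<lambda>m. (\<Sum>k=1..<m. Digamma (of_nat k * \<tau>))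
       + 1/2 * Digamma (of_nat m * \<tau>)
       - 1/\<tau> * (ln_Gamma (of_nat m * \<tau>) - ln (of_real (sqrt (2 * pi)))))"

definition barnes_D :: "complex \<Rightarrow> complex" where
  "barnes_D \<tau> = lim (\<lambda>m. (\<Sum>k=1..<m. Polygamma 1 (of_nat k * \<tau>))
       + 1/2 * Polygamma 1 (of_nat m * \<tau>)
       - 1/\<tau> * Digamma (of_nat m * \<tau>))"

definition barnes_a :: "complex \<Rightarrow> complex" where
  "barnes_a \<tau> = \<tau>/2 * ln (2 * of_real pi * \<tau>) + 1/2 * ln \<tau> - \<tau> * barnes_C \<tau>"

definition barnes_b :: "complex \<Rightarrow> complex" where
  "barnes_b \<tau> = - \<tau> * ln \<tau> - \<tau>\<^sup>2 * barnes_D \<tau>"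

text \<open>
  \<^const>\<open>rGamma\<close> is the entire function \<open>1/\<Gamma>\<close>. \<^const>\<open>prodinf\<close> ranges over all
  natural numbers, so the product over \<open>m \<ge> 1\<close> is indexed by \<^term>\<open>Suc m\<close>.
\<close>

definition barnes_G :: "complex \<Rightarrow> complex \<Rightarrow> complex" where
  "barnes_G z \<tau> =
     1/\<tau> * rGamma z * exp (barnes_a \<tau> * (z/\<tau>) + barnes_b \<tau> * (z\<^sup>2 / (2 * \<tau>\<^sup>2))) *
     (\<Prod>m. Gamma (of_nat (Suc m) * \<tau>) * rGamma (z + of_nat (Suc m) * \<tau>) *
          exp (z * Digamma (of_nat (Suc m) * \<tau>)
               + z\<^sup>2/2 * Polygamma 1 (of_nat (Suc m) * \<tau>)))"


section \<open>The Wiener--Hopf factor of a stable process\<close>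

text \<open>\<open>wh_F w \<alpha>\<close> is \<open>F(w; i/\<alpha>)\<close>, for \<open>\<bar>Im w\<bar> < \<pi>\<close>.\<close>

definition wh_F :: "complex \<Rightarrow> real \<Rightarrow> complex" where
  "wh_F w \<alpha> = (LBINT x. 1 / ((1 + exp (w - of_real (x / \<alpha>))) * (1 + exp (of_real x))))"

text \<open>The values on the positive half-line, for \<open>\<alpha> > 0\<close> and \<open>0 < \<rho> < 1\<close>.\<close>

definition wh_phi_pos :: "real \<Rightarrow> real \<Rightarrow> real \<Rightarrow> complex" where
  "wh_phi_pos z \<alpha> \<rho> = exp (LBINT u:{0<..<z}. 1 / (2 * of_real pi * \<i> * of_real u) *
       (wh_F (of_real pi * \<i> * of_real \<rho> - of_real (ln u)) \<alpha>
        - wh_F (- of_real pi * \<i> * of_real \<rho> - of_real (ln u)) \<alpha>))"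

text \<open>
  The meromorphic continuation from the positive half-line to the plane cut along the
  nonpositive reals. By the identity theorem its values there are unique:
  \<^const>\<open>nicely_meromorphic_on\<close> makes the function continuous at every point that is not
  a pole and gives it the value 0 at the poles, in accordance with \<open>x / 0 = 0\<close>. Values
  on the cut are unspecified.
\<close>

definition wh_phi :: "complex \<Rightarrow> real \<Rightarrow> real \<Rightarrow> complex" where
  "wh_phi z \<alpha> \<rho> =
     (SOME f. f nicely_meromorphic_on (- \<real>\<^sub>\<le>\<^sub>0) \<and>
              (\<forall>x>0. f (of_real x) = wh_phi_pos x \<alpha> \<rho>)) z"

end

theory Submission
  imports Defs
begin

text \<open>
  Write \<open>\<omega> = t + i\<pi>\<rho>\<close> with \<open>t = ln z\<close> for real \<open>z > 0\<close>. Since all four arguments of \<open>G\<close> in the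
  formula are affine in \<open>\<omega>\<close> or in its conjugate, the right-hand side is
  \<open>exp (N \<omega> - N (cnj \<omega>))\<close> for one function \<open>N\<close> (\<open>wh_potential\<close>), analytic in a strip around
  \<open>\<bar>Im v\<bar> \<le> \<pi>\<close> and built from \<open>log G\<close>. So its logarithm is harmonic in \<open>(t, \<pi>\<rho>)\<close> and vanishes
  for \<open>\<rho> = 0\<close>; for \<open>\<rho> = 1\<close> the two points \<open>\<omega>\<close> and \<open>cnj \<omega>\<close> differ by \<open>2\<pi>i\<close>, that is,
  the arguments of \<open>G\<close> differ by \<open>\<alpha>\<close>. The quasi-period relation
  \<open>G(z+\<alpha>;\<alpha>) = (2\<pi>)^((\<alpha>-1)/2) * \<alpha>^(1/2-z) * \<Gamma>(z) * G(z;\<alpha>)\<close> (\<open>log_barnes_shift\<close>) and the reflection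
  formula of \<open>\<Gamma>\<close> on the line \<open>Re z = 1/2\<close> then give the boundary values
  \<open>N (v + i\<pi>) - N (v - i\<pi>) = - ln (1 + exp (\<alpha>v))\<close> (\<open>wh_potential_jump\<close>). In other words, the
  formula is proved by identifying both sides as the solution of one Dirichlet problem in the
  strip \<open>0 < \<pi>\<rho> < \<pi>\<close>, whose boundary values \<open>1\<close> and \<open>1 / (1 + z\<^sup>\<alpha>)\<close> at \<open>\<rho> = 0, 1\<close> are elementary.

  The solution is a Poisson integral. It is obtained from Cauchy's theorem on the rectangles
  \<open>[-T, T] + [-i\<pi>, i\<pi>]\<close>, applied to \<open>N\<close> times a \<open>2\<pi>i\<close>-periodic kernel with poles at \<open>\<omega>\<close> and
  \<open>cnj \<omega>\<close> (\<open>strip_difference_formula\<close>); as \<open>N\<close> grows at most cubically and the kernel decays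
  exponentially, the vertical sides drop out and only the jump of \<open>N\<close> remains:
  \<open>N \<omega> - N (cnj \<omega>) = - (1/2\<pi>) \<integral> sin \<pi>\<rho> / (cosh (v-t) + cos \<pi>\<rho>) * ln (1 + exp (\<alpha>v)) dv\<close>.
  On the other side, the difference of the two values of \<open>F\<close> in the definition of \<open>\<phi>\<close> has the
  same Poisson kernel in its integrand, and the integration over \<open>u\<close> turns the logistic factor
  \<open>1 / (1 + exp x)\<close> into \<open>ln (1 + exp (\<alpha>v))\<close>; everything is nonnegative, so Tonelli's
  theorem applies (\<open>wh_phi_pos_eq\<close>).

  All facts about \<open>G\<close> come from the Taylor expansion of \<open>ln \<Gamma>\<close> at the points \<open>m\<tau>\<close>: the
  \<open>m\<close>-th factor of the product is the exponential of a second-order Taylor remainder, hence of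
  size \<open>O(\<bar>z\<bar>\<^sup>3 / m\<^sup>2)\<close>. This gives at once convergence of the product, entireness of \<open>G\<close>, and
  cubic growth of \<open>log G\<close> on \<open>Re z \<ge> 1/2\<close>.

  For complex \<open>z\<close> the right-hand side is the reciprocal of a holomorphic function on the slit
  plane, since the numerators have arguments with positive real part, where \<open>G\<close> has no zeros.
  So it is a meromorphic continuation with value 0 at its poles, and any two such continuations
  agree (\<open>nicely_meromorphic_identity\<close>).
\<close>

section \<open>Taylor and trapezoid estimates for the logarithm of the Gamma function\<close>

text \<open>
  In the defining series \<open>\<bar>z + k\<bar> \<ge> x + k\<close>. Splitting off \<open>n\<close> factors \<open>1/x\<close> leaves
  \<open>\<Sum>k. 1/(x+k)\<^sup>2\<close>, which telescopes against \<open>1/(x+k-1) - 1/(x+k)\<close> from the second term on.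
\<close>

lemma norm_Polygamma_Suc_le:
  fixes z :: complex
  assumes x: "0 < x" "x \<le> Re z"
  shows "norm (Polygamma (Suc n) z) \<le> fact (Suc n) * (1 / x + 1 / x\<^sup>2) / x ^ n"
proof -
  have partial: "(\<Sum>k<Suc N. 1 / (x + real k)\<^sup>2) \<le> 1 / x + 1 / x\<^sup>2 - 1 / (x + real N)" for N
  proof (induction N)
    case (Suc N)
    define y where "y = x + real N"
    have y: "y > 0" using x by (simp add: y_def add_pos_nonneg)
    have "1 / (y + 1)\<^sup>2 \<le> 1 / (y * (y + 1))"
      using y by (intro divide_left_mono) (auto simp: power2_eq_square)
    also have "\<dots> = 1 / y - 1 / (y + 1)"
      using y by (simp add: field_simps)
    finally have "1 / (x + real (Suc N))\<^sup>2 \<le> 1 / (x + real N) - 1 / (x + real (Suc N))"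
      by (simp add: y_def add_ac)
    then show ?case using Suc.IH by simp
  qed simp
  have bound: "(\<Sum>k<N. 1 / (x + real k)\<^sup>2) \<le> 1 / x + 1 / x\<^sup>2" for N
  proof (cases N)
    case (Suc M)
    have "0 \<le> 1 / (x + real M)" using x by simp
    then show ?thesis using partial[of M] unfolding Suc by linarith
  qed (use x in simp)
  have sq: "summable (\<lambda>k. 1 / (x + real k)\<^sup>2)"
    by (rule summableI_nonneg_bounded[OF _ bound]) auto
  have summand: "norm (inverse ((z + of_nat k) ^ Suc (Suc n))) \<le> 1 / x ^ n * (1 / (x + real k)\<^sup>2)" for k
  proof -
    have "x + real k \<le> Re (z + of_nat k)" using x by simp
    also have "\<dots> \<le> norm (z + of_nat k)" by (rule complex_Re_le_cmod)
    finally have le: "x + real k \<le> norm (z + of_nat k)" .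
    have "x ^ n * (x + real k)\<^sup>2 \<le> norm (z + of_nat k) ^ n * (norm (z + of_nat k))\<^sup>2"
      using x le by (intro mult_mono power_mono) auto
    also have "\<dots> = norm ((z + of_nat k) ^ Suc (Suc n))"
      by (simp add: norm_power norm_mult power2_eq_square)
    finally have "1 / norm ((z + of_nat k) ^ Suc (Suc n)) \<le> 1 / (x ^ n * (x + real k)\<^sup>2)"
      using x by (intro frac_le) (simp_all add: add_pos_nonneg del: power_Suc)
    then show ?thesis by (simp add: norm_inverse norm_divide inverse_eq_divide)
  qed
  have nz: "z \<noteq> 0" using x by auto
  have "norm (\<Sum>k. inverse ((z + of_nat k) ^ Suc (Suc n))) \<le> (\<Sum>k. 1 / x ^ n * (1 / (x + real k)\<^sup>2))"
    by (rule norm_suminf_le[OF summand]) (intro summable_mult sq)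
  also have "\<dots> = 1 / x ^ n * (\<Sum>k. 1 / (x + real k)\<^sup>2)"
    by (rule suminf_mult[OF sq])
  also have "\<dots> \<le> 1 / x ^ n * (1 / x + 1 / x\<^sup>2)"
    using x by (intro mult_left_mono suminf_le_const[OF sq bound]) auto
  finally have "norm (\<Sum>k. inverse ((z + of_nat k) ^ Suc (Suc n))) \<le> (1 / x + 1 / x\<^sup>2) / x ^ n"
    by simp
  then have "fact (Suc n) * norm (\<Sum>k. inverse ((z + of_nat k) ^ Suc (Suc n)))
      \<le> fact (Suc n) * ((1 / x + 1 / x\<^sup>2) / x ^ n)"
    by (intro mult_left_mono) auto
  then show ?thesis
    unfolding Polygamma_def by (simp add: norm_mult norm_power del: fact_Suc power_Suc)
qed

text \<open>
  \<^const>\<open>ln_Gamma\<close> and the \<^const>\<open>Polygamma\<close> functions are put into one family because the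
  constants \<open>C(\<tau>)\<close> and \<open>D(\<tau>)\<close> arise from it in the same way, one derivative apart.
\<close>

definition deriv_ln_Gamma :: "nat \<Rightarrow> complex \<Rightarrow> complex" where
  "deriv_ln_Gamma n = (case n of 0 \<Rightarrow> ln_Gamma | Suc m \<Rightarrow> Polygamma m)"

lemma deriv_ln_Gamma_simps [simp]:
  "deriv_ln_Gamma 0 = ln_Gamma" "deriv_ln_Gamma (Suc m) = Polygamma m"
  by (simp_all add: deriv_ln_Gamma_def)

lemma Re_pos_not_nonpos_Reals: "Re z > 0 \<Longrightarrow> z \<notin> \<real>\<^sub>\<le>\<^sub>0"
  by (auto elim!: nonpos_Reals_cases)

lemma Re_pos_not_nonpos_Ints: "Re z > 0 \<Longrightarrow> z \<notin> \<int>\<^sub>\<le>\<^sub>0"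
  by (auto elim!: nonpos_Ints_cases)

lemma deriv_ln_Gamma_Taylor:
  assumes x: "0 < x" "x \<le> Re w" "x \<le> Re z" and jn: "j + n = Suc m"
  shows "norm (deriv_ln_Gamma j z - (\<Sum>i\<le>n. deriv_ln_Gamma (j + i) w * (z - w) ^ i / fact i))
    \<le> fact (Suc m) * (1 / x + 1 / x\<^sup>2) / x ^ m * norm (z - w) ^ Suc n / fact n"
proof -
  have deriv: "(deriv_ln_Gamma (j + i) has_field_derivative deriv_ln_Gamma (j + Suc i) u)
      (at u within {u. x \<le> Re u})" if "u \<in> {u. x \<le> Re u}" for i u
  proof -
    have "Re u > 0" using that x by simp
    then show ?thesis
      using Re_pos_not_nonpos_Reals[of u] Re_pos_not_nonpos_Ints[of u]
      by (cases "j + i")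
        (auto intro!: has_field_derivative_Polygamma
          has_field_derivative_at_within[OF has_field_derivative_ln_Gamma_complex])
  qed
  have bound: "norm (deriv_ln_Gamma (j + Suc n) u) \<le> fact (Suc m) * (1 / x + 1 / x\<^sup>2) / x ^ m"
    if "u \<in> {u. x \<le> Re u}" for u
    using norm_Polygamma_Suc_le[of x u m] that x jn by (simp del: fact_Suc)
  show ?thesis
    using complex_Taylor[of "{u. x \<le> Re u}" n "\<lambda>i. deriv_ln_Gamma (j + i)", OF
        convex_halfspace_Re_ge deriv bound, of w z] x by (simp del: fact_Suc)
qed

text \<open>
  Comparing the first-order expansion of the derivative with the second-order expansion of the
  function at \<open>w\<close>, the terms up to second order cancel, so that the trapezoid rule for the
  increment has an error of third order.
\<close>

lemma deriv_ln_Gamma_trapezoid: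
  assumes x: "0 < x" "x \<le> Re w" "x \<le> Re z"
  shows "norm (deriv_ln_Gamma j z - deriv_ln_Gamma j w
      - (z - w) / 2 * (deriv_ln_Gamma (Suc j) z + deriv_ln_Gamma (Suc j) w))
    \<le> fact (j + 2) * (1 / x + 1 / x\<^sup>2) / x ^ (j + 1) * norm (z - w) ^ 3"
proof -
  let ?g = deriv_ln_Gamma
  define h where "h = z - w"
  define B where "B = fact (j + 2) * (1 / x + 1 / x\<^sup>2) / x ^ (j + 1)"
  define r1 where "r1 = ?g j z - (?g j w + ?g (Suc j) w * h + ?g (Suc (Suc j)) w * h\<^sup>2 / 2)"
  define r2 where "r2 = ?g (Suc j) z - (?g (Suc j) w + ?g (Suc (Suc j)) w * h)"
  have f2: "(fact (Suc (Suc 0)) :: complex) = 2" "(fact (Suc (Suc 0)) :: real) = 2" by simp_all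
  have r1: "norm r1 \<le> B * norm h ^ 3 / 2"
    using deriv_ln_Gamma_Taylor[OF x, of j 2 "Suc j"]
    by (simp add: r1_def h_def B_def numeral_2_eq_2 numeral_3_eq_3 f2 del: fact_Suc power_Suc)
  have r2: "norm r2 \<le> B * norm h ^ 2"
    using deriv_ln_Gamma_Taylor[OF x, of "Suc j" 1 "Suc j"]
    by (simp add: r2_def h_def B_def numeral_2_eq_2 del: fact_Suc power_Suc deriv_ln_Gamma_simps)
  have "?g j z - ?g j w - h / 2 * (?g (Suc j) z + ?g (Suc j) w) = r1 - h / 2 * r2"
    by (simp add: r1_def r2_def field_simps power2_eq_square del: deriv_ln_Gamma_simps)
  also have "norm \<dots> \<le> norm r1 + norm (h / 2 * r2)" by (rule norm_triangle_ineq4)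
  also have "norm (h / 2 * r2) = norm h / 2 * norm r2" by (simp add: norm_mult norm_divide)
  also have "norm r1 + norm h / 2 * norm r2 \<le> B * norm h ^ 3 / 2 + norm h / 2 * (B * norm h ^ 2)"
    by (intro add_mono r1 mult_left_mono r2) auto
  also have "\<dots> = B * norm h ^ 3" by (simp add: power2_eq_square power3_eq_cube)
  finally show ?thesis by (simp add: h_def B_def del: fact_Suc deriv_ln_Gamma_simps)
qed

text \<open>
  The derivative bounds at the point \<open>x = m\<tau>\<close>, weakened to the quadratic decay in \<open>m\<close> that
  suffices for summation.
\<close>

lemma lattice_decay_le:
  assumes "\<tau> > 0" "m \<ge> (1::nat)"
  shows "(1 / (real m * \<tau>) + 1 / (real m * \<tau>)\<^sup>2) / (real m * \<tau>) ^ Suc j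
    \<le> (1 / \<tau> + 1 / \<tau>\<^sup>2) / \<tau> ^ Suc j * (1 / real m ^ 2)"
proof -
  have m: "real m \<ge> 1" using assms by simp
  have a: "1 / (real m * \<tau>) \<le> 1 / \<tau> * (1 / real m)" by (simp add: field_simps)
  have "1 / (real m * \<tau>)\<^sup>2 = 1 / \<tau>\<^sup>2 * (1 / real m) * (1 / real m)"
    by (simp add: power2_eq_square)
  also have "\<dots> \<le> 1 / \<tau>\<^sup>2 * (1 / real m) * 1"
    using m assms by (intro mult_left_mono) auto
  finally have "1 / (real m * \<tau>) + 1 / (real m * \<tau>)\<^sup>2 \<le> (1 / \<tau> + 1 / \<tau>\<^sup>2) * (1 / real m)"
    using a by (simp add: algebra_simps)
  moreover have "1 / (real m * \<tau>) ^ Suc j \<le> 1 / \<tau> ^ Suc j * (1 / real m)"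
  proof -
    have "1 / (real m * \<tau>) ^ Suc j = 1 / \<tau> ^ Suc j * (1 / real m) * (1 / real m ^ j)"
      by (simp add: power_mult_distrib)
    also have "\<dots> \<le> 1 / \<tau> ^ Suc j * (1 / real m) * 1"
      using m assms by (intro mult_left_mono) auto
    finally show ?thesis by simp
  qed
  ultimately have "(1 / (real m * \<tau>) + 1 / (real m * \<tau>)\<^sup>2) * (1 / (real m * \<tau>) ^ Suc j)
      \<le> ((1 / \<tau> + 1 / \<tau>\<^sup>2) * (1 / real m)) * (1 / \<tau> ^ Suc j * (1 / real m))"
    using assms by (intro mult_mono) auto
  then show ?thesis by (simp add: power2_eq_square mult_ac)
qed

text \<open>
  Consecutive members of the sequence differ by the trapezoid error on \<open>[m\<tau>, (m+1)\<tau>]\<close>,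
  which is summable. The case \<open>j = 0\<close> is the limit defining \<open>C(\<tau>)\<close>, and \<open>j = 1\<close> the one
  defining \<open>D(\<tau>)\<close>.
\<close>

lemma convergent_Polygamma_sum_minus_integral:
  fixes \<tau> :: real
  assumes \<tau>: "\<tau> > 0"
  shows "convergent (\<lambda>m. (\<Sum>k=1..<m. Polygamma j (of_nat k * of_real \<tau>))
      + 1/2 * Polygamma j (of_nat m * of_real \<tau>)
      - 1 / of_real \<tau> * (deriv_ln_Gamma j (of_nat m * of_real \<tau>) - c))" (is "convergent ?c")
proof -
  define A where "A = \<tau>\<^sup>2 * fact (j + 2) * ((1 / \<tau> + 1 / \<tau>\<^sup>2) / \<tau> ^ Suc j)"
  have step: "norm (?c (Suc m) - ?c m) \<le> A * (1 / real m ^ 2)" if m: "m \<ge> 1" for m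
  proof -
    define w z :: complex where "w = of_nat m * of_real \<tau>" and "z = of_nat (Suc m) * of_real \<tau>"
    have zw: "z - w = of_real \<tau>" by (simp add: z_def w_def algebra_simps)
    have xpos: "0 < real m * \<tau>" using m \<tau> by simp
    have re: "real m * \<tau> \<le> Re w" "real m * \<tau> \<le> Re z"
      using \<tau> by (auto simp: w_def z_def)
    define s where "s = (\<Sum>k=1..<m. Polygamma j (of_nat k * complex_of_real \<tau>))"
    have "(\<Sum>k=1..<Suc m. Polygamma j (of_nat k * of_real \<tau>)) = s + Polygamma j w"
      using m by (simp add: w_def s_def)
    then have c_Suc: "?c (Suc m) = s + Polygamma j w + 1/2 * Polygamma j z
        - 1 / of_real \<tau> * (deriv_ln_Gamma j z - c)"
      unfolding z_def by simp
    have c_m: "?c m = s + 1/2 * Polygamma j w - 1 / of_real \<tau> * (deriv_ln_Gamma j w - c)"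
      unfolding w_def s_def ..
    have "?c (Suc m) - ?c m = - (1 / of_real \<tau>) * (deriv_ln_Gamma j z - deriv_ln_Gamma j w
        - (z - w) / 2 * (deriv_ln_Gamma (Suc j) z + deriv_ln_Gamma (Suc j) w))"
      using \<tau> unfolding zw c_Suc c_m by (simp add: field_simps)
    also have "norm \<dots> = 1 / \<tau> * norm (deriv_ln_Gamma j z - deriv_ln_Gamma j w
        - (z - w) / 2 * (deriv_ln_Gamma (Suc j) z + deriv_ln_Gamma (Suc j) w))"
      using \<tau> by (simp add: norm_mult norm_divide del: deriv_ln_Gamma_simps)
    also have "\<dots> \<le> 1 / \<tau> * (fact (j + 2) * (1 / (real m * \<tau>) + 1 / (real m * \<tau>)\<^sup>2)
        / (real m * \<tau>) ^ (j + 1) * norm (z - w) ^ 3)"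
      using \<tau> by (intro mult_left_mono deriv_ln_Gamma_trapezoid[OF xpos re]) auto
    also have "\<dots> = \<tau>\<^sup>2 * fact (j + 2) * ((1 / (real m * \<tau>) + 1 / (real m * \<tau>)\<^sup>2)
        / (real m * \<tau>) ^ Suc j)"
      using \<tau> unfolding zw by (simp add: power2_eq_square power3_eq_cube del: fact_Suc power_Suc)
    also have "\<dots> \<le> \<tau>\<^sup>2 * fact (j + 2) * ((1 / \<tau> + 1 / \<tau>\<^sup>2) / \<tau> ^ Suc j * (1 / real m ^ 2))"
      using \<tau> m by (intro mult_left_mono lattice_decay_le) auto
    finally show ?thesis by (simp add: A_def mult_ac)
  qed
  have "summable (\<lambda>m. ?c (Suc m) - ?c m)"
  proof (rule summable_comparison_test_ev)
    show "\<forall>\<^sub>F m in sequentially. norm (?c (Suc m) - ?c m) \<le> A * (1 / real m ^ 2)"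
      using eventually_ge_at_top[of 1] by eventually_elim (rule step)
    have "summable (\<lambda>m. 1 / real m ^ 2)"
      using inverse_power_summable[of 2, where ?'a = real] by (simp add: inverse_eq_divide)
    then show "summable (\<lambda>m. A * (1 / real m ^ 2))" by (rule summable_mult)
  qed
  then have "convergent (\<lambda>n. ?c n - ?c 0)"
    unfolding summable_iff_convergent sum_lessThan_telescope[of ?c] .
  from convergent_add[OF this convergent_const[of "?c 0"]] show ?thesis by simp
qed

section \<open>The logarithm of the Barnes double gamma function\<close>

text \<open>
  The logarithm of the \<open>m\<close>-th factor in the product for \<open>G(z;\<tau>)\<close>. Up to sign it is the
  remainder of the second-order Taylor expansion of \<open>ln \<Gamma>\<close> at \<open>m\<tau>\<close>, evaluated at \<open>z + m\<tau>\<close>.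
\<close>

definition log_barnes_term :: "real \<Rightarrow> nat \<Rightarrow> complex \<Rightarrow> complex" where
  "log_barnes_term \<tau> m z = ln_Gamma (of_nat m * of_real \<tau>) - ln_Gamma (z + of_nat m * of_real \<tau>)
     + (z * Digamma (of_nat m * of_real \<tau>) + z\<^sup>2 / 2 * Polygamma 1 (of_nat m * of_real \<tau>))"

text \<open>
  The parameter \<open>K\<close> lets \<open>z\<close> range over a half-plane that reaches to the left of the origin;
  on it the segment from \<open>m\<tau>\<close> to \<open>z + m\<tau>\<close> keeps real part at least \<open>(m - K)\<tau>\<close>.
\<close>

lemma norm_log_barnes_term_le:
  assumes \<tau>: "\<tau> > 0" and m: "K < m" and z: "Re z \<ge> - (real K * \<tau>)"
  shows "norm (log_barnes_term \<tau> m z)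
    \<le> (1 / \<tau> + 1 / \<tau>\<^sup>2) / \<tau> * norm z ^ 3 * (1 / real (m - K) ^ 2)"
proof -
  define x where "x = real (m - K) * \<tau>"
  define w where "w = of_nat m * complex_of_real \<tau>"
  have x: "0 < x" using m \<tau> by (simp add: x_def)
  have x_eq: "x = real m * \<tau> - real K * \<tau>" using m by (simp add: x_def of_nat_diff algebra_simps)
  have "0 \<le> real K * \<tau>" using \<tau> by simp
  then have re: "x \<le> Re w" "x \<le> Re (z + w)" using z unfolding x_eq w_def by simp_all
  have f2: "(fact (Suc (Suc 0)) :: complex) = 2" "(fact (Suc (Suc 0)) :: real) = 2" by simp_all
  have "norm (log_barnes_term \<tau> m z) = norm (- log_barnes_term \<tau> m z)" by simp
  also have "- log_barnes_term \<tau> m z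
      = deriv_ln_Gamma 0 (z + w) - (\<Sum>i\<le>2. deriv_ln_Gamma (0 + i) w * (z + w - w) ^ i / fact i)"
    by (simp add: log_barnes_term_def w_def[symmetric] numeral_2_eq_2 f2 del: fact_Suc)
  also have "norm \<dots> \<le> fact (Suc 1) * (1 / x + 1 / x\<^sup>2) / x ^ 1 * norm (z + w - w) ^ Suc 2 / fact 2"
    by (rule deriv_ln_Gamma_Taylor[OF x re]) simp
  also have "\<dots> = (1 / x + 1 / x\<^sup>2) / x ^ Suc 0 * norm z ^ 3"
    using x by (simp add: field_simps power2_eq_square power3_eq_cube)
  also have "\<dots> \<le> (1 / \<tau> + 1 / \<tau>\<^sup>2) / \<tau> ^ Suc 0 * (1 / real (m - K) ^ 2) * norm z ^ 3"
    unfolding x_def using m \<tau> by (intro mult_right_mono lattice_decay_le) auto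
  finally show ?thesis by (simp add: mult_ac)
qed

lemma norm_log_barnes_tail_le:
  assumes \<tau>: "\<tau> > 0" and z: "Re z \<ge> - (real K * \<tau>)"
  shows "norm (log_barnes_term \<tau> (n + Suc K) z)
    \<le> (1 / \<tau> + 1 / \<tau>\<^sup>2) / \<tau> * norm z ^ 3 * (1 / real (Suc n) ^ 2)"
  using norm_log_barnes_term_le[OF \<tau> _ z, of "n + Suc K"]
  by (simp del: of_nat_Suc)

lemma summable_inverse_Suc_square: "summable (\<lambda>n. 1 / real (Suc n) ^ 2)"
  using inverse_power_summable[of 2, where ?'a = real]
  by (subst summable_Suc_iff) (simp add: inverse_eq_divide)

lemma summable_log_barnes_tail:
  assumes "\<tau> > 0" "Re z \<ge> - (real K * \<tau>)"
  shows "summable (\<lambda>n. log_barnes_term \<tau> (n + Suc K) z)"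
  by (rule summable_comparison_test'[OF summable_mult[OF summable_inverse_Suc_square]
        norm_log_barnes_tail_le[OF assms]])

lemma holomorphic_log_barnes_term:
  assumes \<tau>: "\<tau> > 0" and m: "K < m"
  shows "log_barnes_term \<tau> m holomorphic_on {z. Re z > - (real K * \<tau>)}"
proof -
  have "z + of_nat m * of_real \<tau> \<notin> \<real>\<^sub>\<le>\<^sub>0" if "Re z > - (real K * \<tau>)" for z
  proof (rule Re_pos_not_nonpos_Reals)
    have "real K * \<tau> \<le> real m * \<tau>" using m \<tau> by simp
    then show "0 < Re (z + of_nat m * of_real \<tau>)" using that by simp
  qed
  then have "(\<lambda>z. ln_Gamma (z + of_nat m * of_real \<tau>)) holomorphic_on {z. Re z > - (real K * \<tau>)}"
    by (intro holomorphic_on_compose_gen[OF _ holomorphic_ln_Gamma[of "- \<real>\<^sub>\<le>\<^sub>0"], unfolded o_def])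
      (auto intro!: holomorphic_intros)
  then show ?thesis unfolding log_barnes_term_def by (intro holomorphic_intros) auto
qed

lemma holomorphic_log_barnes_tail:
  assumes \<tau>: "\<tau> > 0"
  shows "(\<lambda>z. \<Sum>n. log_barnes_term \<tau> (n + Suc K) z) holomorphic_on {z. Re z > - (real K * \<tau>)}"
    (is "_ holomorphic_on ?S")
proof (rule holomorphic_uniform_sequence)
  show "open ?S" by (rule open_halfspace_Re_gt)
  show "(\<lambda>z. \<Sum>n<N. log_barnes_term \<tau> (n + Suc K) z) holomorphic_on ?S" for N
    by (intro holomorphic_on_sum holomorphic_log_barnes_term \<tau>) simp
  show "\<exists>d>0. cball x d \<subseteq> ?S \<and> uniform_limit (cball x d)
      (\<lambda>N z. \<Sum>n<N. log_barnes_term \<tau> (n + Suc K) z)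
      (\<lambda>z. \<Sum>n. log_barnes_term \<tau> (n + Suc K) z) sequentially" if "x \<in> ?S" for x
  proof -
    have "\<exists>d>0. cball x d \<subseteq> ?S"
      using open_halfspace_Re_gt that unfolding open_contains_cball by (rule bspec)
    then obtain d where d: "d > 0" "cball x d \<subseteq> ?S" by (elim exE conjE)
    have "uniform_limit (cball x d) (\<lambda>N z. \<Sum>n<N. log_barnes_term \<tau> (n + Suc K) z)
        (\<lambda>z. \<Sum>n. log_barnes_term \<tau> (n + Suc K) z) sequentially"
    proof (rule Weierstrass_m_test)
      fix n z assume z: "z \<in> cball x d"
      then have "Re z \<ge> - (real K * \<tau>)" using d(2) by force
      note norm_log_barnes_tail_le[OF \<tau> this, of n]
      also have "norm z \<le> norm x + d"
        using z norm_triangle_ineq2[of z x] by (simp add: dist_norm norm_minus_commute)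
      then have "(1 / \<tau> + 1 / \<tau>\<^sup>2) / \<tau> * norm z ^ 3 * (1 / real (Suc n) ^ 2)
          \<le> (1 / \<tau> + 1 / \<tau>\<^sup>2) / \<tau> * (norm x + d) ^ 3 * (1 / real (Suc n) ^ 2)"
        using \<tau> by (intro mult_right_mono mult_left_mono power_mono) auto
      finally show "norm (log_barnes_term \<tau> (n + Suc K) z)
          \<le> (1 / \<tau> + 1 / \<tau>\<^sup>2) / \<tau> * (norm x + d) ^ 3 * (1 / real (Suc n) ^ 2)" .
    qed (rule summable_mult[OF summable_inverse_Suc_square])
    with d show ?thesis by (intro exI[of _ d] conjI)
  qed
qed

lemma exp_log_barnes_term:
  assumes \<tau>: "\<tau> > 0" and m: "K < m" and z: "Re z > - (real K * \<tau>)"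
  shows "exp (log_barnes_term \<tau> m z) =
    Gamma (of_nat m * of_real \<tau>) * rGamma (z + of_nat m * of_real \<tau>) *
    exp (z * Digamma (of_nat m * of_real \<tau>) + z\<^sup>2/2 * Polygamma 1 (of_nat m * of_real \<tau>))"
proof -
  have "real K * \<tau> \<le> real m * \<tau>" using m \<tau> by simp
  then have "0 < Re (z + of_nat m * of_real \<tau>)" using z by simp
  then have "exp (- ln_Gamma (z + of_nat m * of_real \<tau>)) = rGamma (z + of_nat m * of_real \<tau>)"
    using Re_pos_not_nonpos_Ints by (simp add: rGamma_complex_altdef)
  moreover have "0 < Re (of_nat m * complex_of_real \<tau>)" using m \<tau> by simp
  then have "exp (ln_Gamma (of_nat m * of_real \<tau>)) = Gamma (of_nat m * complex_of_real \<tau>)"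
    using Re_pos_not_nonpos_Ints by (simp only: Gamma_complex_altdef if_False)
  ultimately show ?thesis
    unfolding log_barnes_term_def exp_add diff_conv_add_uminus by (simp only:)
qed

text \<open>
  To the right of \<open>-K\<tau>\<close> only the first \<open>K\<close> factors of the product can vanish; the others form
  the exponential of a convergent series. As \<open>K\<close> is arbitrary, this makes \<open>G\<close> entire, and for
  \<open>K = 0\<close> it gives a logarithm of \<open>G\<close> on the right half-plane.
\<close>

lemma barnes_G_eq_exp_tail:
  assumes \<tau>: "\<tau> > 0" and z: "Re z > - (real K * \<tau>)"
  shows "barnes_G z (of_real \<tau>) =
    1 / of_real \<tau> * rGamma z *
    exp (barnes_a \<tau> * (z / of_real \<tau>) + barnes_b \<tau> * (z\<^sup>2 / (2 * (of_real \<tau>)\<^sup>2))) *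
    ((\<Prod>m<K. Gamma (of_nat (Suc m) * of_real \<tau>) * rGamma (z + of_nat (Suc m) * of_real \<tau>) *
        exp (z * Digamma (of_nat (Suc m) * of_real \<tau>)
             + z\<^sup>2/2 * Polygamma 1 (of_nat (Suc m) * of_real \<tau>))) *
      exp (\<Sum>n. log_barnes_term \<tau> (n + Suc K) z))"
proof -
  define F where "F = (\<lambda>m. Gamma (of_nat (Suc m) * of_real \<tau>) * rGamma (z + of_nat (Suc m) * of_real \<tau>) *
        exp (z * Digamma (of_nat (Suc m) * of_real \<tau>)
             + z\<^sup>2/2 * Polygamma 1 (of_nat (Suc m) * complex_of_real \<tau>)))"
  have tail: "F (n + K) = exp (log_barnes_term \<tau> (n + Suc K) z)" for n
    using exp_log_barnes_term[OF \<tau> _ z, of "n + Suc K"] by (simp add: F_def)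
  have summ: "summable (\<lambda>n. log_barnes_term \<tau> (n + Suc K) z)"
    using summable_log_barnes_tail[OF \<tau>] z by simp
  have "convergent_prod F"
    by (rule convergent_prod_offset[of _ K]) (unfold tail, rule convergent_prod_exp[OF summ])
  from convergent_prod_LIMSEQ[OF this] have "(\<lambda>n. \<Prod>i\<le>n. F i) \<longlonglongrightarrow> prodinf F" .
  then have "(\<lambda>n. \<Prod>i<n. F i) \<longlonglongrightarrow> prodinf F"
    by (subst filterlim_sequentially_Suc[symmetric]) (simp add: lessThan_Suc_atMost)
  from LIMSEQ_ignore_initial_segment[OF this, of K]
  have "(\<lambda>n. \<Prod>i<n + K. F i) \<longlonglongrightarrow> prodinf F" .
  moreover have "(\<Prod>i<n + K. F i) = (\<Prod>i<K. F i) * exp (\<Sum>i<n. log_barnes_term \<tau> (i + Suc K) z)" for n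
    by (induction n) (simp_all add: tail exp_add)
  moreover have "(\<lambda>n. (\<Prod>i<K. F i) * exp (\<Sum>i<n. log_barnes_term \<tau> (i + Suc K) z))
      \<longlonglongrightarrow> (\<Prod>i<K. F i) * exp (\<Sum>i. log_barnes_term \<tau> (i + Suc K) z)"
    by (intro tendsto_intros summable_LIMSEQ[OF summ])
  ultimately have "prodinf F = (\<Prod>i<K. F i) * exp (\<Sum>i. log_barnes_term \<tau> (i + Suc K) z)"
    using LIMSEQ_unique by fastforce
  then show ?thesis unfolding barnes_G_def F_def by simp
qed

lemma entire_barnes_G:
  assumes \<tau>: "\<tau> > 0"
  shows "(\<lambda>z. barnes_G z (of_real \<tau>)) holomorphic_on UNIV"
proof -
  let ?S = "\<lambda>K. {z. Re z > - (real K * \<tau>)}"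
  have "(\<lambda>z. barnes_G z (of_real \<tau>)) holomorphic_on ?S K" for K
    by (rule holomorphic_transform[OF _ barnes_G_eq_exp_tail[OF \<tau>, symmetric]])
      (auto intro!: holomorphic_intros holomorphic_log_barnes_tail[OF \<tau>, of K, simplified] simp: \<tau>)
  then have "(\<lambda>z. barnes_G z (of_real \<tau>)) holomorphic_on (\<Union>K. ?S K)"
    by (intro holomorphic_on_UN_open open_halfspace_Re_gt)
  moreover have "(\<Union>K. ?S K) = UNIV"
  proof (intro equalityI subsetI UNIV_I)
    fix z :: complex
    obtain K :: nat where "- Re z < real K * \<tau>"
      using reals_Archimedean3[OF \<tau>] by blast
    then have "z \<in> ?S K" by simp
    then show "z \<in> (\<Union>K. ?S K)" by blast
  qed
  ultimately show ?thesis by simp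
qed

definition log_barnes :: "real \<Rightarrow> complex \<Rightarrow> complex" where
  "log_barnes \<tau> z = - of_real (ln \<tau>) - ln_Gamma z
     + (barnes_a \<tau> * (z / of_real \<tau>) + barnes_b \<tau> * (z\<^sup>2 / (2 * (of_real \<tau>)\<^sup>2)))
     + (\<Sum>n. log_barnes_term \<tau> (Suc n) z)"

lemma barnes_G_eq_exp_log_barnes:
  assumes \<tau>: "\<tau> > 0" and z: "Re z > 0"
  shows "barnes_G z (of_real \<tau>) = exp (log_barnes \<tau> z)"
proof -
  have "exp (- complex_of_real (ln \<tau>)) = 1 / of_real \<tau>"
    using \<tau> by (simp add: exp_minus exp_of_real inverse_eq_divide)
  moreover have "exp (- ln_Gamma z) = rGamma z"
    using z by (simp add: rGamma_complex_altdef Re_pos_not_nonpos_Ints)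
  ultimately show ?thesis
    using barnes_G_eq_exp_tail[of \<tau> 0 z] z \<tau>
    unfolding log_barnes_def diff_conv_add_uminus exp_add by simp
qed

lemma holomorphic_log_barnes:
  assumes "\<tau> > 0"
  shows "log_barnes \<tau> holomorphic_on {z. Re z > 0}"
proof -
  have "ln_Gamma holomorphic_on {z. Re z > 0}"
    by (rule holomorphic_ln_Gamma) (use Re_pos_not_nonpos_Reals in auto)
  then show ?thesis
    unfolding log_barnes_def[abs_def] using holomorphic_log_barnes_tail[OF assms, of 0]
    by (auto intro!: holomorphic_intros simp: assms)
qed

text \<open>
  The series is bounded by a multiple of \<open>\<bar>z\<bar>\<^sup>3\<close>, and \<open>ln \<Gamma> z\<close> is quadratically bounded by its
  first-order expansion at 1.
\<close>

lemma log_barnes_growth: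
  assumes \<tau>: "\<tau> > 0"
  obtains A where "\<And>z. Re z \<ge> 1/2 \<Longrightarrow> norm (log_barnes \<tau> z) \<le> A * (1 + norm z) ^ 3"
proof -
  define A1 where "A1 = norm (ln \<tau>) + norm (Digamma (1::complex)) + 6"
  define A2 where "A2 = norm (barnes_a \<tau>) / \<tau> + norm (barnes_b \<tau>) / (2 * \<tau>\<^sup>2)"
  define A3 where "A3 = (1 / \<tau> + 1 / \<tau>\<^sup>2) / \<tau> * (\<Sum>n. 1 / real (Suc n) ^ 2)"
  have "norm (log_barnes \<tau> z) \<le> (A1 + A2 + A3) * (1 + norm z) ^ 3" if z: "Re z \<ge> 1/2" for z
  proof -
    define R where "R = 1 + norm z"
    have R: "R \<ge> 1" by (simp add: R_def)
    have R3: "1 \<le> R ^ 3" "R \<le> R ^ 3" "R ^ 2 \<le> R ^ 3"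
      using R power_increasing[of 1 3 R] power_increasing[of 0 3 R] power_increasing[of 2 3 R]
      by auto
    have nz: "norm z \<le> R" "norm (z - 1) \<le> R"
      using norm_triangle_ineq4[of z 1] by (simp_all add: R_def)
    have lnG: "norm (ln_Gamma z) \<le> (norm (Digamma (1::complex)) + 6) * R ^ 3"
    proof -
      have "norm (ln_Gamma z - (z - 1) * Digamma 1)
          = norm (deriv_ln_Gamma 0 z - (\<Sum>i\<le>1. deriv_ln_Gamma (0 + i) 1 * (z - 1) ^ i / fact i))"
        using ln_Gamma_complex_conv_fact[of 1] by (simp add: mult.commute)
      also have "\<dots> \<le> fact (Suc 0) * (1 / (1/2) + 1 / (1/2)\<^sup>2) / (1/2) ^ 0 * norm (z - 1) ^ Suc 1 / fact 1"
        using z by (intro deriv_ln_Gamma_Taylor) auto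
      also have "\<dots> = 6 * norm (z - 1) ^ 2" by (simp add: power2_eq_square)
      also have "\<dots> \<le> 6 * R ^ 2" using nz by (intro mult_left_mono power_mono) auto
      also have "\<dots> \<le> 6 * R ^ 3" using R3 by simp
      finally have "norm (ln_Gamma z - (z - 1) * Digamma 1) \<le> 6 * R ^ 3" .
      moreover have "norm ((z - 1) * Digamma 1) \<le> R ^ 3 * norm (Digamma (1::complex))"
        using nz R3 by (simp only: norm_mult) (intro mult_right_mono, auto)
      moreover have "norm (ln_Gamma z) \<le> norm (ln_Gamma z - (z - 1) * Digamma 1) + norm ((z - 1) * Digamma 1)"
        by (rule norm_triangle_sub[of _ "(z - 1) * Digamma 1", unfolded add.commute[of "norm ((z-1) * Digamma 1)"]])
      ultimately show ?thesis by (simp add: algebra_simps)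
    qed
    have "norm (barnes_a \<tau> * (z / of_real \<tau>) + barnes_b \<tau> * (z\<^sup>2 / (2 * (of_real \<tau>)\<^sup>2)))
        \<le> norm (barnes_a \<tau>) / \<tau> * norm z + norm (barnes_b \<tau>) / (2 * \<tau>\<^sup>2) * (norm z)\<^sup>2"
      using \<tau> by (intro order_trans[OF norm_triangle_ineq]) (simp add: norm_mult norm_divide norm_power)
    also have "\<dots> \<le> norm (barnes_a \<tau>) / \<tau> * R ^ 3 + norm (barnes_b \<tau>) / (2 * \<tau>\<^sup>2) * R ^ 3"
    proof (intro add_mono mult_left_mono)
      show "norm z \<le> R ^ 3" using nz R3 by linarith
      have "(norm z)\<^sup>2 \<le> R\<^sup>2" using nz by (intro power_mono) auto
      then show "(norm z)\<^sup>2 \<le> R ^ 3" using R3 by linarith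
    qed (use \<tau> in auto)
    finally have quad: "norm (barnes_a \<tau> * (z / of_real \<tau>) + barnes_b \<tau> * (z\<^sup>2 / (2 * (of_real \<tau>)\<^sup>2)))
        \<le> A2 * R ^ 3" by (simp add: A2_def algebra_simps)
    have "norm (\<Sum>n. log_barnes_term \<tau> (Suc n) z)
        \<le> (\<Sum>n. (1 / \<tau> + 1 / \<tau>\<^sup>2) / \<tau> * norm z ^ 3 * (1 / real (Suc n) ^ 2))"
      using norm_log_barnes_tail_le[OF \<tau>, of 0 z] z
      by (intro norm_suminf_le summable_mult summable_inverse_Suc_square) auto
    also have "\<dots> = (1 / \<tau> + 1 / \<tau>\<^sup>2) / \<tau> * norm z ^ 3 * (\<Sum>n. 1 / real (Suc n) ^ 2)"
      by (rule suminf_mult[OF summable_inverse_Suc_square])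
    also have "\<dots> = A3 * norm z ^ 3" by (simp add: A3_def)
    also have "\<dots> \<le> A3 * R ^ 3"
      using \<tau> nz unfolding A3_def
      by (intro mult_left_mono power_mono mult_nonneg_nonneg suminf_nonneg summable_inverse_Suc_square) auto
    finally have ser: "norm (\<Sum>n. log_barnes_term \<tau> (Suc n) z) \<le> A3 * R ^ 3" .
    have "norm (- complex_of_real (ln \<tau>)) \<le> norm (ln \<tau>) * R ^ 3"
      using mult_left_mono[OF R3(1), of "norm (ln \<tau>)"] by simp
    moreover have "norm (log_barnes \<tau> z) \<le> norm (- complex_of_real (ln \<tau>)) + norm (ln_Gamma z)
        + norm (barnes_a \<tau> * (z / of_real \<tau>) + barnes_b \<tau> * (z\<^sup>2 / (2 * (of_real \<tau>)\<^sup>2)))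
        + norm (\<Sum>n. log_barnes_term \<tau> (Suc n) z)"
    proof -
      have "norm (p - q + r + s) \<le> norm p + norm q + norm r + norm s" for p q r s :: complex
        using norm_triangle_ineq[of "p - q + r" s] norm_triangle_ineq[of "p - q" r]
          norm_triangle_ineq4[of p q] by linarith
      then show ?thesis unfolding log_barnes_def .
    qed
    ultimately have "norm (log_barnes \<tau> z)
        \<le> norm (ln \<tau>) * R ^ 3 + (norm (Digamma (1::complex)) + 6) * R ^ 3 + A2 * R ^ 3 + A3 * R ^ 3"
      using lnG quad ser by linarith
    then show ?thesis by (simp add: A1_def R_def algebra_simps)
  qed
  then show thesis by (rule that)
qed

text \<open>
  The quasi-period relation, as an exact identity of logarithms. In the difference of the two
  series the values of \<open>ln \<Gamma>\<close> telescope, and the sums of \<open>\<psi>(k\<tau>)\<close> and \<open>\<psi>'(k\<tau>)\<close> that remain are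
  exactly those whose renormalised limits are \<open>C(\<tau>)\<close> and \<open>D(\<tau>)\<close>. These constants
  then cancel against the ones in the exponential prefactor of \<open>G\<close>.
\<close>

lemma log_barnes_shift:
  assumes \<tau>: "\<tau> > 0" and z: "Re z > 0"
  shows "log_barnes \<tau> (z + of_real \<tau>) - log_barnes \<tau> z
    = ln_Gamma z + of_real ((\<tau> - 1) / 2 * ln (2 * pi)) + (1/2 - z) * of_real (ln \<tau>)"
proof -
  define t where "t = complex_of_real \<tau>"
  have t: "t \<noteq> 0" using \<tau> by (simp add: t_def)
  define l where "l = complex_of_real (ln (2 * pi)) / 2"
  have l: "ln (of_real (sqrt (2 * pi))) = l"
    by (simp add: l_def Ln_of_real ln_sqrt)
  define c where "c = (\<lambda>m. (\<Sum>k=1..<m. Digamma (of_nat k * t)) + 1/2 * Digamma (of_nat m * t)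
      - 1 / t * (ln_Gamma (of_nat m * t) - l))"
  define d where "d = (\<lambda>m. (\<Sum>k=1..<m. Polygamma 1 (of_nat k * t)) + 1/2 * Polygamma 1 (of_nat m * t)
      - 1 / t * Digamma (of_nat m * t))"
  have c: "c \<longlonglongrightarrow> barnes_C t"
    using convergent_Polygamma_sum_minus_integral[OF \<tau>, of 0 l]
    unfolding convergent_LIMSEQ_iff barnes_C_def l c_def t_def by simp
  have d: "d \<longlonglongrightarrow> barnes_D t"
    using convergent_Polygamma_sum_minus_integral[OF \<tau>, of 1 0]
    unfolding convergent_LIMSEQ_iff barnes_D_def d_def t_def by simp
  define P where "P = (\<lambda>N. \<Sum>n<N. log_barnes_term \<tau> (Suc n) (z + t) - log_barnes_term \<tau> (Suc n) z)"
  have P_lim: "P \<longlonglongrightarrow> (\<Sum>n. log_barnes_term \<tau> (Suc n) (z + t)) - (\<Sum>n. log_barnes_term \<tau> (Suc n) z)"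
    unfolding P_def sum_subtractf
    using summable_log_barnes_tail[OF \<tau>, of 0] z \<tau>
    by (intro tendsto_diff summable_LIMSEQ) (auto simp: t_def)
  define q where "q = z * t + t\<^sup>2 / 2"
  have P_eq: "P N = ln_Gamma (z + t) - ln_Gamma (z + of_nat (Suc N) * t)
      + t * (\<Sum>k=1..<Suc N. Digamma (of_nat k * t)) + q * (\<Sum>k=1..<Suc N. Polygamma 1 (of_nat k * t))" for N
  proof (induction N)
    case 0
    show ?case by (simp add: P_def)
  next
    case (Suc N)
    have step: "P (Suc N) = P N + (log_barnes_term \<tau> (Suc N) (z + t) - log_barnes_term \<tau> (Suc N) z)"
      by (simp add: P_def)
    have diff: "log_barnes_term \<tau> (Suc N) (z + t) - log_barnes_term \<tau> (Suc N) z
        = ln_Gamma (z + of_nat (Suc N) * t) - ln_Gamma (z + of_nat (Suc (Suc N)) * t)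
          + t * Digamma (of_nat (Suc N) * t) + q * Polygamma 1 (of_nat (Suc N) * t)"
      by (simp add: log_barnes_term_def t_def[symmetric] q_def power2_eq_square algebra_simps)
    have split: "(\<Sum>k=1..<Suc (Suc N). f k) = (\<Sum>k=1..<Suc N. f k) + f (Suc N)"
      for f :: "nat \<Rightarrow> complex"
      by (rule sum.atLeastLessThan_Suc) simp
    define S0 S1 where "S0 = (\<Sum>k=1..<Suc N. Digamma (of_nat k * t))"
      and "S1 = (\<Sum>k=1..<Suc N. Polygamma 1 (of_nat k * t))"
    show ?case
      unfolding step diff Suc.IH split S0_def[symmetric] S1_def[symmetric] by (simp only: algebra_simps)
  qed
  \<comment> \<open>The boundary terms at \<open>N\<tau>\<close> that \<open>C\<close> and \<open>D\<close> leave behind form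
    a first-order Taylor remainder of \<open>ln \<Gamma>\<close>, so they vanish in the limit.\<close>
  define e where "e = (\<lambda>N. ln_Gamma (of_nat N * t + (z + t)) - ln_Gamma (of_nat N * t) - (z + t) * Digamma (of_nat N * t))"
  have P_eq': "P N = t * c N + q * d N + q / 2 * Polygamma 1 (of_nat N * t) - e N - l + ln_Gamma (z + t)"
    if N: "N \<ge> 1" for N
  proof -
    have shift: "z + of_nat (Suc N) * t = of_nat N * t + (z + t)" by (simp add: algebra_simps)
    have split: "(\<Sum>k=1..<Suc N. f k) = (\<Sum>k=1..<N. f k) + f N" for f :: "nat \<Rightarrow> complex"
      using N by simp
    show ?thesis unfolding P_eq shift split c_def d_def e_def q_def
      using t by (simp add: field_simps power2_eq_square)
  qed
  have inv0: "(\<lambda>N. 1 / (real N * \<tau>) + 1 / (real N * \<tau>)\<^sup>2) \<longlonglongrightarrow> 0"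
  proof -
    have "(\<lambda>N. 1 / \<tau> * (1 / real N) + 1 / \<tau>\<^sup>2 * (1 / real N * (1 / real N)))
        \<longlonglongrightarrow> 1 / \<tau> * 0 + 1 / \<tau>\<^sup>2 * (0 * 0)"
      by (intro tendsto_intros lim_1_over_n)
    then show ?thesis by (simp add: power2_eq_square mult_ac)
  qed
  have psi1: "(\<lambda>N. Polygamma 1 (of_nat N * t)) \<longlonglongrightarrow> 0"
  proof (rule Lim_null_comparison[OF _ inv0])
    show "\<forall>\<^sub>F N in sequentially. norm (Polygamma 1 (of_nat N * t)) \<le> 1 / (real N * \<tau>) + 1 / (real N * \<tau>)\<^sup>2"
      using eventually_ge_at_top[of 1]
    proof eventually_elim
      case (elim N)
      then show ?case using norm_Polygamma_Suc_le[of "real N * \<tau>" "of_nat N * t" 0] \<tau>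
        by (simp add: t_def)
    qed
  qed
  have e0: "e \<longlonglongrightarrow> 0"
  proof (rule Lim_null_comparison)
    show "\<forall>\<^sub>F N in sequentially. norm (e N) \<le> (1 / (real N * \<tau>) + 1 / (real N * \<tau>)\<^sup>2) * norm (z + t) ^ 2"
      using eventually_ge_at_top[of 1]
    proof eventually_elim
      case (elim N)
      then have "0 < real N * \<tau>" "real N * \<tau> \<le> Re (of_nat N * t)" "real N * \<tau> \<le> Re (of_nat N * t + (z + t))"
        using \<tau> z by (auto simp: t_def)
      from deriv_ln_Gamma_Taylor[OF this, of 0 1 0] show ?case
        by (simp add: e_def power2_eq_square mult_ac diff_diff_eq)
    qed
    show "(\<lambda>N. (1 / (real N * \<tau>) + 1 / (real N * \<tau>)\<^sup>2) * norm (z + t) ^ 2) \<longlonglongrightarrow> 0"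
      using tendsto_mult_right[OF inv0, of "norm (z + t) ^ 2"] by simp
  qed
  have "(\<lambda>N. t * c N + q * d N + q / 2 * Polygamma 1 (of_nat N * t) - e N - l + ln_Gamma (z + t))
      \<longlonglongrightarrow> t * barnes_C t + q * barnes_D t + q / 2 * 0 - 0 - l + ln_Gamma (z + t)"
    by (intro tendsto_intros c d psi1 e0)
  moreover have "\<forall>\<^sub>F N in sequentially. t * c N + q * d N + q / 2 * Polygamma 1 (of_nat N * t) - e N - l
      + ln_Gamma (z + t) = P N"
    using eventually_ge_at_top[of 1] by eventually_elim (simp add: P_eq')
  ultimately have "P \<longlonglongrightarrow> t * barnes_C t + q * barnes_D t + q / 2 * 0 - 0 - l + ln_Gamma (z + t)"
    by (rule Lim_transform_eventually)
  then have "P \<longlonglongrightarrow> t * barnes_C t + q * barnes_D t - l + ln_Gamma (z + t)" by simp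
  from LIMSEQ_unique[OF P_lim this]
  have series: "(\<Sum>n. log_barnes_term \<tau> (Suc n) (z + t)) - (\<Sum>n. log_barnes_term \<tau> (Suc n) z)
      = t * barnes_C t + q * barnes_D t - l + ln_Gamma (z + t)" .
  define L where "L = complex_of_real (ln \<tau>)"
  have lnt: "ln t = L" using \<tau> by (simp add: t_def L_def Ln_of_real)
  have ln2t: "ln (2 * of_real pi * t) = 2 * l + L"
  proof -
    have "2 * of_real pi * t = of_real (2 * pi * \<tau>)" by (simp add: t_def)
    also have "ln \<dots> = of_real (ln (2 * pi * \<tau>))"
      using \<tau> by (intro Ln_of_real) simp
    also have "ln (2 * pi * \<tau>) = ln (2 * pi) + ln \<tau>" using \<tau> by (simp add: ln_mult)
    finally show ?thesis by (simp add: l_def L_def)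
  qed
  have a_eq: "barnes_a t = t * l + L / 2 + t * L / 2 - t * barnes_C t"
    unfolding barnes_a_def lnt ln2t by (simp add: field_simps)
  have b_eq: "barnes_b t * q / t\<^sup>2 = - (q * L / t) - q * barnes_D t"
    unfolding barnes_b_def lnt using t by (simp add: field_simps power2_eq_square)
  have "log_barnes \<tau> (z + t) - log_barnes \<tau> z
      = ln_Gamma z - ln_Gamma (z + t) + (barnes_a t * (z + t) / t - barnes_a t * z / t)
        + (barnes_b t * (z + t)\<^sup>2 / (2 * t\<^sup>2) - barnes_b t * z\<^sup>2 / (2 * t\<^sup>2))
        + ((\<Sum>n. log_barnes_term \<tau> (Suc n) (z + t)) - (\<Sum>n. log_barnes_term \<tau> (Suc n) z))"
    by (simp add: log_barnes_def t_def[symmetric])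
  also have "barnes_a t * (z + t) / t - barnes_a t * z / t = barnes_a t"
    using t by (simp add: field_simps)
  also have "barnes_b t * (z + t)\<^sup>2 / (2 * t\<^sup>2) - barnes_b t * z\<^sup>2 / (2 * t\<^sup>2) = barnes_b t * q / t\<^sup>2"
    using t by (simp add: field_simps power2_eq_square q_def)
  also have "ln_Gamma z - ln_Gamma (z + t) + barnes_a t + barnes_b t * q / t\<^sup>2
      + ((\<Sum>n. log_barnes_term \<tau> (Suc n) (z + t)) - (\<Sum>n. log_barnes_term \<tau> (Suc n) z))
      = ln_Gamma z + (t * l + L / 2 + t * L / 2) - l - q * L / t"
    unfolding series a_eq b_eq by simp
  also have "q * L / t = (z + t / 2) * L" using t by (simp add: q_def field_simps power2_eq_square)
  also have "ln_Gamma z + (t * l + L / 2 + t * L / 2) - l - (z + t / 2) * L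
      = ln_Gamma z + (t - 1) * l + (1/2 - z) * L" by (simp add: algebra_simps)
  finally show ?thesis by (simp add: t_def l_def L_def)
qed

section \<open>A difference equation in a strip\<close>

text \<open>
  Up to the factor \<open>2\<pi>\<close>, this is the Poisson kernel of the strip of width \<open>\<pi>\<close>, evaluated at
  height \<open>y\<close>, for boundary data on the line at height \<open>\<pi>\<close>.
\<close>

definition strip_kernel :: "real \<Rightarrow> real \<Rightarrow> real" where
  "strip_kernel y v = sin y / (cosh v + cos y)"

lemma strip_kernel_denom_pos:
  fixes v y :: real
  assumes "0 < y" "y < pi"
  shows "cosh v + cos y > 0"
proof -
  have "cos pi < cos y" using assms by (intro cos_monotone_0_pi) auto
  moreover have "cosh v \<ge> 1" by (rule cosh_real_ge_1)
  ultimately show ?thesis by simp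
qed

lemma strip_kernel_nonneg: "0 < y \<Longrightarrow> y < pi \<Longrightarrow> 0 \<le> strip_kernel y v"
  using strip_kernel_denom_pos[of y v] sin_gt_zero[of y] by (simp add: strip_kernel_def)

lemma strip_kernel_even: "strip_kernel y (- v) = strip_kernel y v"
  by (simp add: strip_kernel_def)

text \<open>
  The two terms on the left are complex conjugates, so that their difference is \<open>2i\<close> times an
  imaginary part; its denominator is \<open>\<bar>1 + exp (-v + iy)\<bar>\<^sup>2 = 2 exp (-v) (cosh v + cos y)\<close>.
  This identity links the two sides of the theorem: the left-hand side occurs both in the
  difference of two values of \<open>F\<close> and in the Cauchy kernel of the strip.
\<close>

lemma strip_kernel_eq:
  assumes y: "0 < y" "y < pi"
  shows "1 / (1 + exp (Complex (- v) y)) - 1 / (1 + exp (Complex (- v) (- y)))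
    = - \<i> * of_real (strip_kernel y v)"
proof -
  define r where "r = exp (- v)"
  have r: "r > 0" by (simp add: r_def)
  define E where "E = exp (Complex (- v) y)"
  have E: "E = Complex (r * cos y) (r * sin y)"
    by (simp add: E_def r_def complex_eq_iff Re_exp Im_exp)
  have cE: "exp (Complex (- v) (- y)) = cnj E"
    by (simp add: E r_def complex_eq_iff Re_exp Im_exp)
  have ch: "2 * r * (cosh v + cos y) = 1 + 2 * r * cos y + r\<^sup>2"
    by (simp add: r_def cosh_def field_simps power2_eq_square exp_minus)
  define c s where "c = cos y" and "s = sin y"
  have cs: "c\<^sup>2 + s\<^sup>2 = 1" by (simp add: c_def s_def)
  have "(1 + r * c)\<^sup>2 + (r * s)\<^sup>2 = 1 + 2 * r * c + r\<^sup>2 * (c\<^sup>2 + s\<^sup>2)"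
    by (simp add: power2_eq_square algebra_simps)
  then have sq: "(1 + r * cos y)\<^sup>2 + (r * sin y)\<^sup>2 = 2 * r * (cosh v + cos y)"
    unfolding cs ch by (simp add: c_def s_def)
  have n: "(1 + E) * cnj (1 + E) = of_real (2 * r * (cosh v + cos y))"
    unfolding complex_mult_cnj sq[symmetric] by (simp add: E)
  have pos: "2 * r * (cosh v + cos y) > 0"
    using r strip_kernel_denom_pos[OF y, of v] by simp
  have nz: "1 + E \<noteq> 0" "cnj (1 + E) \<noteq> 0"
    using n pos by (metis mult_zero_left mult_zero_right of_real_eq_0_iff less_irrefl)+
  have "1 / (1 + E) - 1 / cnj (1 + E) = (cnj E - E) / ((1 + E) * cnj (1 + E))"
    using nz by (simp add: divide_simps)
  also have "cnj E - E = of_real (2 * r) * (- \<i> * of_real (sin y))"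
    by (simp add: E complex_eq_iff)
  also have "\<dots> / ((1 + E) * cnj (1 + E)) = - \<i> * of_real (strip_kernel y v)"
  proof -
    have nz2: "of_real (2 * r) \<noteq> (0::complex)" using r by simp
    show ?thesis
      unfolding n strip_kernel_def of_real_mult[of "2 * r" "cosh v + cos y"]
      by (simp only: mult_divide_mult_cancel_left[OF nz2] of_real_divide times_divide_eq_right)
  qed
  finally show ?thesis by (simp add: cE E_def[symmetric])
qed

lemma has_contour_integral_linepath_translate:
  "(f has_contour_integral I) (linepath (a + d) (b + d))
    \<longleftrightarrow> ((\<lambda>z. f (z + d)) has_contour_integral I) (linepath a b)"
  unfolding has_contour_integral_linepath
  by (simp add: linepath_def algebra_simps flip: scaleR_add_left)

lemma has_contour_integral_linepath_same_Im_iff: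
  assumes "a < b"
  shows "(f has_contour_integral I) (linepath (Complex a c) (Complex b c))
    \<longleftrightarrow> ((\<lambda>x. f (Complex x c)) has_integral I) {a..b}"
proof -
  have "Complex a c = of_real a + \<i> * of_real c" "Complex b c = of_real b + \<i> * of_real c"
    by (simp_all add: complex_eq_iff)
  then have "(f has_contour_integral I) (linepath (Complex a c) (Complex b c))
      \<longleftrightarrow> ((\<lambda>z. f (z + \<i> * of_real c)) has_contour_integral I) (linepath (of_real a) (of_real b))"
    by (simp only: has_contour_integral_linepath_translate)
  also have "\<dots> \<longleftrightarrow> ((\<lambda>x. f (of_real x + \<i> * of_real c)) has_integral I) {a..b}"
    using assms by (subst has_contour_integral_linepath_Reals_iff) auto
  also have "(\<lambda>x. f (of_real x + \<i> * of_real c)) = (\<lambda>x. f (Complex x c))"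
    by (intro ext arg_cong[of _ _ f]) (simp add: complex_eq_iff)
  finally show ?thesis .
qed

lemma tendsto_over_one_minus_exp:
  fixes p :: complex
  shows "((\<lambda>v. (v - p) / (1 - exp (p - v))) \<longlongrightarrow> 1) (at p)"
proof -
  have "((\<lambda>v. 1 - exp (p - v)) has_field_derivative 1) (at p)"
    by (auto intro!: derivative_eq_intros)
  then have "((\<lambda>v. (1 - exp (p - v)) / (v - p)) \<longlongrightarrow> 1) (at p)"
    by (simp add: has_field_derivative_iff)
  from tendsto_inverse[OF this] show ?thesis by simp
qed

lemma norm_strip_Cauchy_kernel_le:
  assumes r: "r = exp (t - Re v)" "r \<noteq> 1"
  shows "norm (1 / (1 - exp (Complex t y - v)) - 1 / (1 - exp (Complex t (- y) - v)))
    \<le> 2 * r / (1 - r)\<^sup>2"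
proof -
  define a b where "a = exp (Complex t y - v)" and "b = exp (Complex t (- y) - v)"
  have n: "norm a = r" "norm b = r" by (simp_all add: a_def b_def r)
  have ge: "\<bar>1 - r\<bar> \<le> norm (1 - a)" "\<bar>1 - r\<bar> \<le> norm (1 - b)"
    using norm_triangle_ineq3[of 1 a] norm_triangle_ineq3[of 1 b] by (simp_all add: n)
  have pos: "0 < \<bar>1 - r\<bar>" using r by simp
  have nz: "1 - a \<noteq> 0" "1 - b \<noteq> 0" using ge pos by auto
  have "1 / (1 - a) - 1 / (1 - b) = (a - b) / ((1 - a) * (1 - b))"
    using nz by (simp add: divide_simps)
  also have "norm \<dots> = norm (a - b) / (norm (1 - a) * norm (1 - b))"
    by (simp add: norm_divide norm_mult)
  also have "\<dots> \<le> (2 * r) / (\<bar>1 - r\<bar> * \<bar>1 - r\<bar>)"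
    using ge pos norm_triangle_ineq4[of a b] n by (intro frac_le mult_mono mult_pos_pos) auto
  finally show ?thesis by (simp add: a_def b_def power2_eq_square)
qed

text \<open>
  An analytic function of cubic growth on the strip is determined up to a constant by its jump
  between the two boundary lines. The kernel
  \<open>1 / (1 - exp (\<omega> - v)) - 1 / (1 - exp (cnj \<omega> - v))\<close> has period \<open>2\<pi>i\<close> in \<open>v\<close>, so it takes the
  same values on the two horizontal sides of the rectangle \<open>[-T, T] + [-i\<pi>, i\<pi>]\<close>; its residues
  at \<open>\<omega>\<close> and \<open>cnj \<omega>\<close> are \<open>1\<close> and \<open>-1\<close>. Each term of the kernel tends to 1 at the right end of
  the strip, but their difference decays exponentially at both ends. The rectangles produce the
  integral as a symmetric limit; \<open>nn_integral_eq_tendsto_symmetric\<close> later turns it into an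
  absolutely convergent one.
\<close>

lemma strip_difference_formula:
  fixes N :: "complex \<Rightarrow> complex" and l :: "real \<Rightarrow> real"
  assumes b: "b > pi" and holo: "N holomorphic_on {v. \<bar>Im v\<bar> < b}"
    and growth: "\<And>v. \<bar>Im v\<bar> \<le> pi \<Longrightarrow> norm (N v) \<le> A * (1 + norm v) ^ 3"
    and jump: "\<And>v. N (Complex v pi) - N (Complex v (- pi)) = - of_real (l v)"
    and y: "0 < y" "y < pi"
  shows "((\<lambda>T. integral {-T..T} (\<lambda>v. of_real (strip_kernel y (v - t) * l v)))
    \<longlongrightarrow> - 2 * of_real pi * (N (Complex t y) - N (Complex t (- y)))) at_top"
proof -
  define w w' where "w = Complex t y" and "w' = Complex t (- y)"
  define k where "k = (\<lambda>v. 1 / (1 - exp (w - v)) - 1 / (1 - exp (w' - v)))"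
  define f where "f = (\<lambda>v. N v * k v)"
  \<comment> \<open>The strip is widened so little that no translate of \<open>\<omega>\<close> or \<open>cnj \<omega>\<close> by
    a nonzero multiple of \<open>2\<pi>i\<close> enters it.\<close>
  define \<delta> where "\<delta> = min (b - pi) (pi - y)"
  have \<delta>: "\<delta> > 0" "\<delta> \<le> b - pi" "\<delta> \<le> pi - y" using b y by (auto simp: \<delta>_def)
  define S where "S = {v. \<bar>Im v\<bar> < pi + \<delta>}"
  have S_eq: "S = {v. Im v < pi + \<delta>} \<inter> {v. Im v > - (pi + \<delta>)}" by (auto simp: S_def)
  have "open S" unfolding S_eq by (intro open_Int open_halfspace_Im_lt open_halfspace_Im_gt)
  have "convex S" unfolding S_eq by (intro convex_Int convex_halfspace_Im_lt convex_halfspace_Im_gt)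
  have ww': "w \<in> S" "w' \<in> S" "w \<noteq> w'" using y \<delta> by (auto simp: S_def w_def w'_def)
  have one: "exp u = 1 \<longleftrightarrow> u = 0" if "\<bar>Im u\<bar> < 2 * pi" for u
  proof
    assume "exp u = 1"
    then obtain n :: int where n: "Re u = 0" "Im u = of_int (2 * n) * pi"
      unfolding exp_eq_1 by blast
    have "\<bar>of_int (2 * n)\<bar> * pi < 2 * pi" using that n by (simp add: abs_mult)
    then have "n = 0" by simp
    then show "u = 0" using n by (simp add: complex_eq_iff)
  qed simp
  have denom: "1 - exp (w - v) \<noteq> 0" if "v \<in> S - {w}" for v
  proof -
    have "\<bar>Im (w - v)\<bar> < 2 * pi" using that y \<delta> by (auto simp: S_def w_def abs_if split: if_splits)
    from one[OF this] show ?thesis using that by auto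
  qed
  have denom': "1 - exp (w' - v) \<noteq> 0" if "v \<in> S - {w'}" for v
  proof -
    have "\<bar>Im (w' - v)\<bar> < 2 * pi" using that y \<delta> by (auto simp: S_def w'_def abs_if split: if_splits)
    from one[OF this] show ?thesis using that by auto
  qed
  have holoN: "N holomorphic_on S"
    by (rule holomorphic_on_subset[OF holo]) (use \<delta> in \<open>auto simp: S_def\<close>)
  have holof: "f holomorphic_on S - {w, w'}"
    unfolding f_def k_def using denom denom'
    by (intro holomorphic_intros holomorphic_on_subset[OF holoN]) auto
  have contN: "isCont N v" if "v \<in> S" for v
    using holoN \<open>open S\<close> that holomorphic_on_imp_continuous_on continuous_on_eq_continuous_at by blast
  have res: "residue f w = N w"
  proof (rule residue_simple'[of "S - {w'}"])
    have "((\<lambda>v. N v * ((v - w) / (1 - exp (w - v))) - N v * ((v - w) / (1 - exp (w' - v))))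
        \<longlongrightarrow> N w * 1 - N w * ((w - w) / (1 - exp (w' - w)))) (at w)"
      using contN[OF ww'(1)] denom'[of w] ww'
      by (intro tendsto_intros tendsto_over_one_minus_exp) (auto simp: isCont_def)
    then show "((\<lambda>v. f v * (v - w)) \<longlongrightarrow> N w) (at w)"
      by (simp add: f_def k_def algebra_simps)
    show "open (S - {w'})" using \<open>open S\<close> by (intro open_Diff closed_singleton)
    show "w \<in> S - {w'}" using ww' by simp
    have "S - {w'} - {w} = S - {w, w'}" by fast
    then show "f holomorphic_on S - {w'} - {w}" using holof by (simp only:)
  qed
  have res': "residue f w' = - N w'"
  proof (rule residue_simple'[of "S - {w}"])
    have "((\<lambda>v. N v * ((v - w') / (1 - exp (w - v))) - N v * ((v - w') / (1 - exp (w' - v))))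
        \<longlongrightarrow> N w' * ((w' - w') / (1 - exp (w - w'))) - N w' * 1) (at w')"
      using contN[OF ww'(2)] denom[of w'] ww'
      by (intro tendsto_intros tendsto_over_one_minus_exp) (auto simp: isCont_def)
    then show "((\<lambda>v. f v * (v - w')) \<longlongrightarrow> - N w') (at w')"
      by (simp add: f_def k_def algebra_simps)
    show "open (S - {w})" using \<open>open S\<close> by (intro open_Diff closed_singleton)
    show "w' \<in> S - {w}" using ww' by simp
    have "S - {w} - {w'} = S - {w, w'}" by fast
    then show "f holomorphic_on S - {w} - {w'}" using holof by (simp only:)
  qed

  define V where "V = (\<lambda>T. contour_integral (linepath (Complex T (-pi)) (Complex T pi)) f
      + contour_integral (linepath (Complex (-T) pi) (Complex (-T) (-pi))) f)"
  define J where "J = (\<lambda>T. integral {-T..T} (\<lambda>v. complex_of_real (strip_kernel y (v - t) * l v)))"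
  have rect: "2 * of_real pi * \<i> * (N w - N w') = - \<i> * J T + V T" if T: "T > \<bar>t\<bar>" for T
  proof -
    define a1 a3 where "a1 = Complex (-T) (-pi)" and "a3 = Complex T pi"
    have T0: "T > 0" using T by linarith
    have cbox_S: "cbox a1 a3 \<subseteq> S"
      using \<delta> by (auto simp: a1_def a3_def in_cbox_complex_iff S_def)
    have inbox: "w \<in> box a1 a3" "w' \<in> box a1 a3"
      using T y by (auto simp: a1_def a3_def in_box_complex_iff w_def w'_def)
    have image: "path_image (rectpath a1 a3) = cbox a1 a3 - box a1 a3"
      using T0 by (intro path_image_rectpath_cbox_minus_box) (auto simp: a1_def a3_def)
    have "contour_integral (rectpath a1 a3) f
        = 2 * pi * \<i> * (\<Sum>p\<in>{w, w'}. winding_number (rectpath a1 a3) p * residue f p)"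
    proof (rule Residue_theorem[OF \<open>open S\<close> convex_connected[OF \<open>convex S\<close>] _ holof])
      show "path_image (rectpath a1 a3) \<subseteq> S - {w, w'}" using image cbox_S inbox by auto
      show "\<forall>z. z \<notin> S \<longrightarrow> winding_number (rectpath a1 a3) z = 0"
        using cbox_S T0 by (auto intro!: winding_number_rectpath_outside simp: a1_def a3_def)
    qed auto
    also have "\<dots> = 2 * of_real pi * \<i> * (N w - N w')"
      using ww' by (simp add: winding_number_rectpath inbox res res')
    finally have total: "contour_integral (rectpath a1 a3) f = 2 * of_real pi * \<i> * (N w - N w')" .
    have int: "f contour_integrable_on linepath p q"
      if "p \<in> {a1, Complex T (-pi), a3, Complex (-T) pi}" "q \<in> {a1, Complex T (-pi), a3, Complex (-T) pi}"
        "closed_segment p q \<subseteq> path_image (rectpath a1 a3)" for p q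
    proof (rule contour_integrable_continuous_linepath)
      have "path_image (rectpath a1 a3) \<subseteq> S - {w, w'}" using image cbox_S inbox by auto
      then show "continuous_on (closed_segment p q) f"
        using that holomorphic_on_imp_continuous_on[OF holof] continuous_on_subset by blast
    qed
    have seg: "path_image (rectpath a1 a3) = closed_segment a1 (Complex T (-pi))
        \<union> closed_segment (Complex T (-pi)) a3 \<union> closed_segment a3 (Complex (-T) pi)
        \<union> closed_segment (Complex (-T) pi) a1"
      by (simp add: rectpath_def Let_def path_image_join a1_def a3_def Un_assoc)
    have ints: "f contour_integrable_on linepath a1 (Complex T (-pi))"
      "f contour_integrable_on linepath (Complex T (-pi)) a3"
      "f contour_integrable_on linepath a3 (Complex (-T) pi)"
      "f contour_integrable_on linepath (Complex (-T) pi) a1"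
      by (rule int; use seg in blast)+
    have "contour_integral (rectpath a1 a3) f = contour_integral (linepath a1 (Complex T (-pi))) f
        + contour_integral (linepath (Complex T (-pi)) a3) f
        + contour_integral (linepath a3 (Complex (-T) pi)) f
        + contour_integral (linepath (Complex (-T) pi) a1) f"
      using ints by (simp add: rectpath_def Let_def a1_def a3_def add_ac valid_path_join
          contour_integrable_joinI)
    also have "contour_integral (linepath a3 (Complex (-T) pi)) f
        = - contour_integral (linepath (Complex (-T) pi) a3) f"
      by (metis contour_integral_reversepath reversepath_linepath valid_path_linepath)
    finally have total': "contour_integral (rectpath a1 a3) f
        = contour_integral (linepath a1 (Complex T (-pi))) f
          - contour_integral (linepath (Complex (-T) pi) a3) f + V T"
      by (simp add: V_def a1_def a3_def)
    have "(f has_contour_integral contour_integral (linepath a1 (Complex T (-pi))) f)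
        (linepath a1 (Complex T (-pi)))"
      using ints(1) by (rule has_contour_integral_integral)
    then have lower: "((\<lambda>v. f (Complex v (-pi))) has_integral
        contour_integral (linepath a1 (Complex T (-pi))) f) {-T..T}"
      unfolding a1_def using T0 by (subst (asm) has_contour_integral_linepath_same_Im_iff) auto
    have "f contour_integrable_on linepath (Complex (-T) pi) a3"
      using contour_integrable_reversepath[OF valid_path_linepath ints(3)] by simp
    then have "(f has_contour_integral contour_integral (linepath (Complex (-T) pi) a3) f)
        (linepath (Complex (-T) pi) a3)"
      by (rule has_contour_integral_integral)
    then have upper: "((\<lambda>v. f (Complex v pi)) has_integral
        contour_integral (linepath (Complex (-T) pi) a3) f) {-T..T}"
      unfolding a3_def using T0 by (subst (asm) has_contour_integral_linepath_same_Im_iff) auto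
    have "f (Complex v (-pi)) - f (Complex v pi)
        = - \<i> * of_real (strip_kernel y (v - t) * l v)" for v
    proof -
      have e: "exp (Complex a c - Complex v pi) = - exp (Complex (- (v - a)) c)"
        "exp (Complex a c - Complex v (-pi)) = - exp (Complex (- (v - a)) c)" for a c
        by (simp_all add: complex_eq_iff Re_exp Im_exp cos_diff sin_diff cos_add sin_add)
      have k: "k (Complex v pi) = - \<i> * of_real (strip_kernel y (v - t))"
        "k (Complex v (-pi)) = - \<i> * of_real (strip_kernel y (v - t))"
        using strip_kernel_eq[OF y, of "v - t"] by (simp_all add: k_def w_def w'_def e)
      have "f (Complex v (-pi)) - f (Complex v pi)
          = - (N (Complex v pi) - N (Complex v (-pi))) * (- \<i> * of_real (strip_kernel y (v - t)))"
        unfolding f_def k by (simp add: algebra_simps)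
      then show ?thesis unfolding jump by simp
    qed
    with has_integral_diff[OF lower upper]
    have "((\<lambda>v. - \<i> * of_real (strip_kernel y (v - t) * l v)) has_integral
      (contour_integral (linepath a1 (Complex T (-pi))) f
          - contour_integral (linepath (Complex (-T) pi) a3) f)) {-T..T}"
      by (simp only:)
    then have "integral {-T..T} (\<lambda>v. - \<i> * of_real (strip_kernel y (v - t) * l v))
        = contour_integral (linepath a1 (Complex T (-pi))) f
          - contour_integral (linepath (Complex (-T) pi) a3) f"
      by (rule integral_unique)
    moreover have "integral {-T..T} (\<lambda>v. - \<i> * of_real (strip_kernel y (v - t) * l v)) = - \<i> * J T"
      unfolding J_def by (rule integral_mult_right)
    ultimately show ?thesis using total total' by simp
  qed

  \<comment> \<open>A bound for the integrand on the vertical sides: \<open>1 + \<bar>v\<bar> \<le> 6T\<close> there,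
    and \<open>8 exp (\<bar>t\<bar> - T)\<close> bounds the kernel.\<close>
  define B where "B = (\<lambda>T. \<bar>A\<bar> * (6 * T) ^ 3 * (8 * (exp \<bar>t\<bar> / exp T)) :: real)"
  have fbound: "norm (f v) \<le> B T"
    if v: "\<bar>Re v\<bar> = T" "\<bar>Im v\<bar> \<le> pi" and T: "T \<ge> \<bar>t\<bar> + 1" for v T
  proof -
    have T1: "T \<ge> 1" using T by simp
    have "norm v \<le> T + pi" using cmod_le[of v] v by simp
    then have "1 + norm v \<le> 6 * T" using T1 pi_less_4 by simp
    have "norm (N v) \<le> A * (1 + norm v) ^ 3" by (rule growth[OF v(2)])
    also have "\<dots> \<le> \<bar>A\<bar> * (6 * T) ^ 3"
      using \<open>1 + norm v \<le> 6 * T\<close> by (intro mult_mono power_mono) auto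
    finally have Nb: "norm (N v) \<le> \<bar>A\<bar> * (6 * T) ^ 3" .
    define r where "r = exp (t - Re v)"
    have e2: "exp (1::real) \<ge> 2" using exp_ge_add_one_self[of 1] by simp
    have kb: "2 * r / (1 - r)\<^sup>2 \<le> 8 * (exp \<bar>t\<bar> / exp T) \<and> r \<noteq> 1"
    proof (cases "Re v \<ge> 0")
      case True
      then have Re: "Re v = T" using v by simp
      have r: "r \<le> exp \<bar>t\<bar> / exp T" by (simp add: r_def Re exp_diff divide_right_mono)
      have "r \<le> exp (-1)" using T by (simp add: r_def Re)
      also have "\<dots> \<le> 1/2" using e2 by (simp add: exp_minus field_simps)
      finally have half: "r \<le> 1/2" .
      have "2 * r / (1 - r)\<^sup>2 \<le> 2 * r / (1/2)\<^sup>2"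
        using half by (intro frac_le power_mono) (auto simp: r_def)
      also have "\<dots> = 8 * r" by (simp add: power2_eq_square)
      finally show ?thesis using r half by auto
    next
      case False
      then have Re: "Re v = - T" using v by simp
      have "r = exp T * exp t" by (simp add: r_def Re exp_add)
      moreover have "exp t \<ge> 1 / exp \<bar>t\<bar>" by (simp add: exp_minus[symmetric] inverse_eq_divide[symmetric])
      ultimately have r: "r \<ge> exp T / exp \<bar>t\<bar>" using mult_left_mono[of "1 / exp \<bar>t\<bar>" "exp t" "exp T"] by simp
      have "exp 1 \<le> r" using T by (simp add: r_def Re)
      then have two: "2 \<le> r" using e2 by simp
      have "2 * r / (1 - r)\<^sup>2 = 2 * r / (r - 1)\<^sup>2" by (simp add: power2_commute)
      also have "\<dots> \<le> 2 * r / (r / 2)\<^sup>2"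
        using two by (intro divide_left_mono power_mono) auto
      also have "\<dots> = 8 * (1 / r)" using two by (simp add: power2_eq_square field_simps)
      also have "1 / r \<le> exp \<bar>t\<bar> / exp T" using r two by (simp add: field_simps)
      finally show ?thesis using two by auto
    qed
    have "norm (k v) \<le> 8 * (exp \<bar>t\<bar> / exp T)"
      using norm_strip_Cauchy_kernel_le[OF r_def, of y] kb
      unfolding k_def w_def w'_def by linarith
    then show ?thesis unfolding f_def B_def norm_mult
      using Nb T1 by (intro mult_mono) auto
  qed
  have Vbound: "norm (V T) \<le> 4 * pi * B T" if T: "T \<ge> \<bar>t\<bar> + 1" for T
  proof -
    have vert: "norm (contour_integral (linepath (Complex x c) (Complex x (-c))) f) \<le> B T * (2 * pi)"
      if x: "\<bar>x\<bar> = T" and c: "\<bar>c\<bar> = pi" for x c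
    proof -
      have segv: "\<bar>Re v\<bar> = T \<and> \<bar>Im v\<bar> \<le> pi" if "v \<in> closed_segment (Complex x c) (Complex x (-c))" for v
        using that x c by (auto simp: closed_segment_same_Re closed_segment_eq_real_ivl split: if_splits)
      have "continuous_on (closed_segment (Complex x c) (Complex x (-c))) f"
      proof (rule continuous_on_subset[OF holomorphic_on_imp_continuous_on[OF holof]])
        have "v \<in> S - {w, w'}" if "v \<in> closed_segment (Complex x c) (Complex x (-c))" for v
          using segv[OF that] T \<delta> by (auto simp: S_def w_def w'_def)
        then show "closed_segment (Complex x c) (Complex x (-c)) \<subseteq> S - {w, w'}" by blast
      qed
      then have "f contour_integrable_on linepath (Complex x c) (Complex x (-c))"
        by (rule contour_integrable_continuous_linepath)
      moreover have "0 \<le> B T" using T by (simp add: B_def)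
      ultimately have "norm (contour_integral (linepath (Complex x c) (Complex x (-c))) f)
          \<le> B T * norm (Complex x (-c) - Complex x c)"
        using fbound segv T by (intro contour_integral_bound_linepath) auto
      also have "norm (Complex x (-c) - Complex x c) = 2 * pi"
        using c by (simp add: cmod_eq_Im)
      finally show ?thesis .
    qed
    have "\<bar>T\<bar> = T" "\<bar>-T\<bar> = T" using T by auto
    with vert[of T "-pi"] vert[of "-T" pi] norm_triangle_ineq
    have "norm (V T) \<le> B T * (2 * pi) + B T * (2 * pi)"
      unfolding V_def by (intro order_trans[OF norm_triangle_ineq] add_mono) auto
    then show ?thesis by (simp add: algebra_simps)
  qed
  have V0: "(V \<longlongrightarrow> 0) at_top"
  proof (rule Lim_null_comparison)
    show "\<forall>\<^sub>F T in at_top. norm (V T) \<le> 4 * pi * B T"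
      using eventually_ge_at_top[of "\<bar>t\<bar> + 1"] by eventually_elim (rule Vbound)
    have "((\<lambda>T. (4 * pi * \<bar>A\<bar> * 216 * 8 * exp \<bar>t\<bar>) * (T ^ 3 / exp T)) \<longlongrightarrow> (4 * pi * \<bar>A\<bar> * 216 * 8 * exp \<bar>t\<bar>) * 0) at_top"
      by (intro tendsto_intros tendsto_power_div_exp_0)
    then show "((\<lambda>T. 4 * pi * B T) \<longlongrightarrow> 0) at_top"
      by (simp add: B_def power_mult_distrib mult_ac)
  qed
  have "((\<lambda>T. - 2 * of_real pi * (N w - N w') - \<i> * V T)
      \<longlongrightarrow> - 2 * of_real pi * (N w - N w') - \<i> * 0) at_top"
    by (intro tendsto_intros V0)
  moreover have "\<forall>\<^sub>F T in at_top. - 2 * of_real pi * (N w - N w') - \<i> * V T = J T"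
    using eventually_gt_at_top[of "\<bar>t\<bar>"]
  proof eventually_elim
    case (elim T)
    have "\<i> * (2 * of_real pi * \<i> * (N w - N w')) = \<i> * (- \<i> * J T + V T)"
      unfolding rect[OF elim] ..
    then show ?case by (simp add: algebra_simps)
  qed
  ultimately have "(J \<longlongrightarrow> - 2 * of_real pi * (N w - N w') - \<i> * 0) at_top"
    by (rule Lim_transform_eventually)
  then show ?thesis unfolding J_def w_def w'_def by simp
qed

section \<open>The Wiener--Hopf factor as a Poisson integral\<close>

lemma integrable_exp_minus_abs:
  fixes m :: real
  assumes m: "m > 0"
  shows "integrable lborel (\<lambda>x. exp (- m * \<bar>x\<bar>))"
proof -
  define f where "f = (\<lambda>x. indicator {0..} x * exp (- m * x) :: real)"
  have [measurable]: "f \<in> borel_measurable lborel" unfolding f_def by measurable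
  have lim: "((\<lambda>x. - exp (- m * x) / m) \<longlongrightarrow> 0) at_top"
  proof -
    have "filterlim (\<lambda>x. m * x) at_top at_top"
      using m by (intro filterlim_tendsto_pos_mult_at_top[OF tendsto_const] filterlim_ident)
    then have "((\<lambda>x. exp (- (m * x))) \<longlongrightarrow> 0) at_top"
      by (intro filterlim_compose[OF exp_at_bot] filterlim_uminus_at_bot[THEN iffD1])
        (simp add: filterlim_uminus_at_bot)
    then show ?thesis using tendsto_divide[OF tendsto_minus tendsto_const, of _ 0 at_top m] m by simp
  qed
  have "(\<integral>\<^sup>+x. ennreal (exp (- m * x)) * indicator {0..} x \<partial>lborel) = 0 - (- exp (- m * 0) / m)"
    using m lim by (intro nn_integral_FTC_atLeast) (auto intro!: derivative_eq_intros)
  also have "(\<integral>\<^sup>+x. ennreal (exp (- m * x)) * indicator {0..} x \<partial>lborel) = (\<integral>\<^sup>+x. ennreal (norm (f x)) \<partial>lborel)"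
    by (intro nn_integral_cong) (auto simp: f_def split: split_indicator)
  finally have f: "integrable lborel f"
    by (intro integrableI_bounded) auto
  have f': "integrable lborel (\<lambda>x. f (0 + -1 * x))"
    by (rule lborel_integrable_real_affine[OF f]) simp
  show ?thesis
    by (rule Bochner_Integration.integrable_bound[OF Bochner_Integration.integrable_add[OF f f']])
      (auto simp: f_def split: split_indicator)
qed

text \<open>
  From \<open>\<bar>1 + r exp (iy)\<bar>\<^sup>2 = cos\<^sup>2(y/2) (1 + r)\<^sup>2 + sin\<^sup>2(y/2) (1 - r)\<^sup>2\<close>.
\<close>

lemma norm_one_plus_exp_ge:
  assumes y: "\<bar>y\<bar> < pi"
  shows "norm (1 + exp (Complex s y)) \<ge> cos (y / 2) * (1 + exp s)"
proof -
  define r where "r = exp s"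
  have c: "cos y = 2 * (cos (y / 2))\<^sup>2 - 1" using cos_double_cos[of "y / 2"] by simp
  have c1: "(cos (y / 2))\<^sup>2 \<le> 1" by (simp add: abs_square_le_1)
  have sc: "(sin y)\<^sup>2 = 1 - (cos y)\<^sup>2" by (simp add: sin_squared_eq)
  have "(norm (1 + exp (Complex s y)))\<^sup>2 = (1 + r * cos y)\<^sup>2 + (r * sin y)\<^sup>2"
    by (simp add: cmod_power2 Re_exp Im_exp r_def)
  also have "\<dots> = 1 + 2 * r * cos y + r\<^sup>2"
    unfolding power_mult_distrib sc by (simp add: power2_eq_square algebra_simps)
  also have "\<dots> = (cos (y / 2) * (1 + r))\<^sup>2 + (1 - (cos (y / 2))\<^sup>2) * (1 - r)\<^sup>2"
    unfolding c by (simp add: power2_eq_square algebra_simps)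
  also have "\<dots> \<ge> (cos (y / 2) * (1 + r))\<^sup>2" using c1 by simp
  finally have "(cos (y / 2) * (1 + r))\<^sup>2 \<le> (norm (1 + exp (Complex s y)))\<^sup>2" .
  then show ?thesis unfolding r_def by (rule power2_le_imp_le) simp
qed

text \<open>
  The factor \<open>1 / (1 + exp x)\<close> gives decay at \<open>+\<infinity>\<close>, the other one decay at \<open>-\<infinity>\<close>. The lower
  bound \<open>norm_one_plus_exp_ge\<close> reduces the second to the real case \<open>y = 0\<close>.
\<close>

lemma integrable_wh_F:
  assumes a: "a > 0" and y: "\<bar>y\<bar> < pi"
  shows "integrable lborel
    (\<lambda>x. 1 / ((1 + exp (Complex s y - of_real (x / a))) * (1 + exp (complex_of_real x))))"
proof (rule Bochner_Integration.integrable_bound)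
  define m where "m = min 1 (1 / a)"
  have m: "m > 0" "m \<le> 1" "m \<le> 1 / a" using a by (auto simp: m_def)
  define A where "A = max 1 (exp (- s)) / cos (y / 2)"
  have cpos: "cos (y / 2) > 0" using y by (intro cos_gt_zero_pi) auto
  show "integrable lborel (\<lambda>x. A * exp (- m * \<bar>x\<bar>))"
    by (intro integrable_mult_right integrable_exp_minus_abs m)
  show "AE x in lborel. norm (1 / ((1 + exp (Complex s y - of_real (x / a))) * (1 + exp (complex_of_real x))))
      \<le> norm (A * exp (- m * \<bar>x\<bar>))"
  proof (rule AE_I2)
    fix x :: real
    define p q where "p = 1 + exp (s - x / a)" and "q = 1 + exp x"
    have pq: "p \<ge> 1" "q \<ge> 1" by (simp_all add: p_def q_def)
    have "Complex s y - of_real (x / a) = Complex (s - x / a) y" by (simp add: complex_eq_iff)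
    then have n1: "norm (1 + exp (Complex s y - of_real (x / a))) \<ge> cos (y / 2) * p"
      using norm_one_plus_exp_ge[OF y, of "s - x / a"] by (simp add: p_def)
    have "1 + exp (complex_of_real x) = of_real q" by (simp add: q_def exp_of_real)
    then have n2: "norm (1 + exp (complex_of_real x)) = q" using pq by simp
    have decay: "1 / (p * q) \<le> max 1 (exp (- s)) * exp (- m * \<bar>x\<bar>)"
    proof (cases "x \<ge> 0")
      case True
      have "1 / (p * q) \<le> 1 / exp x"
        using pq by (intro frac_le) (auto simp: q_def intro: order_trans[OF _ mult_right_mono[of 1 p]])
      also have "\<dots> = exp (- x)" by (simp add: exp_minus field_simps)
      also have "\<dots> \<le> exp (- m * \<bar>x\<bar>)" using True m by (simp add: mult_left_le_one_le)
      also have "\<dots> \<le> max 1 (exp (- s)) * exp (- m * \<bar>x\<bar>)" by simp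
      finally show ?thesis .
    next
      case False
      have "exp (s - x / a) \<le> p * q"
        using pq mult_left_mono[of 1 q p] by (simp add: p_def)
      then have "1 / (p * q) \<le> 1 / exp (s - x / a)" by (intro frac_le) auto
      also have "\<dots> = exp (- s) * exp (x / a)" by (simp add: exp_diff exp_minus field_simps)
      also have "\<dots> \<le> max 1 (exp (- s)) * exp (- m * \<bar>x\<bar>)"
      proof (intro mult_mono)
        have "(1 / a) * x \<le> m * x" using False m by (intro mult_right_mono_neg) auto
        then show "exp (x / a) \<le> exp (- m * \<bar>x\<bar>)" using False by simp
      qed auto
      finally show ?thesis .
    qed
    have "norm (1 / ((1 + exp (Complex s y - of_real (x / a))) * (1 + exp (complex_of_real x))))
        = 1 / (norm (1 + exp (Complex s y - of_real (x / a))) * q)"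
      by (simp add: norm_divide norm_mult n2)
    also have "\<dots> \<le> 1 / (cos (y / 2) * p * q)"
      using n1 cpos pq by (intro frac_le mult_right_mono mult_pos_pos) auto
    also have "\<dots> = (1 / (p * q)) / cos (y / 2)" by simp
    also have "\<dots> \<le> (max 1 (exp (- s)) * exp (- m * \<bar>x\<bar>)) / cos (y / 2)"
      using decay cpos by (intro divide_right_mono) auto
    also have "\<dots> = A * exp (- m * \<bar>x\<bar>)" by (simp add: A_def)
    also have "\<dots> \<le> norm \<dots>" by simp
    finally show "norm (1 / ((1 + exp (Complex s y - of_real (x / a))) * (1 + exp (complex_of_real x))))
      \<le> norm (A * exp (- m * \<bar>x\<bar>))" .
  qed
qed measurable

lemma measurable_strip_kernel [measurable]:
  assumes [measurable]: "f \<in> borel_measurable M"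
  shows "(\<lambda>x. strip_kernel y (f x)) \<in> borel_measurable M"
  unfolding strip_kernel_def cosh_def by measurable

lemma wh_F_diff:
  assumes a: "a > 0" and y: "0 < y" "y < pi"
  shows "integrable lborel (\<lambda>x. strip_kernel y (s + x / a) / (1 + exp x))"
    and "wh_F (Complex (- s) y) a - wh_F (Complex (- s) (- y)) a
      = - \<i> * of_real (\<integral>x. strip_kernel y (s + x / a) / (1 + exp x) \<partial>lborel)"
proof -
  let ?f = "\<lambda>y x. 1 / ((1 + exp (Complex (- s) y - of_real (x / a))) * (1 + exp (complex_of_real x)))"
  have int: "integrable lborel (?f y)" "integrable lborel (?f (- y))"
    using integrable_wh_F[OF a, of y "- s"] integrable_wh_F[OF a, of "- y" "- s"] y by simp_all
  have eq: "?f y x - ?f (- y) x = - \<i> * of_real (strip_kernel y (s + x / a) / (1 + exp x))" for x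
  proof -
    have e: "Complex (- s) c - of_real (x / a) = Complex (- (s + x / a)) c" for c
      by (simp add: complex_eq_iff)
    have "?f y x - ?f (- y) x = (1 / (1 + exp (Complex (- (s + x / a)) y))
        - 1 / (1 + exp (Complex (- (s + x / a)) (- y)))) / (1 + exp (complex_of_real x))"
      unfolding e by (simp add: diff_divide_distrib)
    also have "\<dots> = - \<i> * of_real (strip_kernel y (s + x / a)) / (1 + exp (complex_of_real x))"
      unfolding strip_kernel_eq[OF y] ..
    finally show ?thesis by (simp add: exp_of_real)
  qed
  have "integrable lborel (\<lambda>x. \<i> * (?f y x - ?f (- y) x))"
    by (intro integrable_mult_right Bochner_Integration.integrable_diff int)
  then have "integrable lborel (\<lambda>x. complex_of_real (strip_kernel y (s + x / a) / (1 + exp x)))"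
    unfolding eq by simp
  then show intk: "integrable lborel (\<lambda>x. strip_kernel y (s + x / a) / (1 + exp x))"
    by (simp only: complex_of_real_integrable_eq)
  have "wh_F (Complex (- s) y) a - wh_F (Complex (- s) (- y)) a = (\<integral>x. ?f y x - ?f (- y) x \<partial>lborel)"
    unfolding wh_F_def by (rule Bochner_Integration.integral_diff[OF int, symmetric])
  also have "\<dots> = - \<i> * (\<integral>x. of_real (strip_kernel y (s + x / a) / (1 + exp x)) \<partial>lborel)"
    unfolding eq by (rule integral_mult_right_zero)
  also have "\<dots> = - \<i> * of_real (\<integral>x. strip_kernel y (s + x / a) / (1 + exp x) \<partial>lborel)"
    by (simp only: integral_complex_of_real)
  finally show "wh_F (Complex (- s) y) a - wh_F (Complex (- s) (- y)) a
      = - \<i> * of_real (\<integral>x. strip_kernel y (s + x / a) / (1 + exp x) \<partial>lborel)" .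
qed

text \<open>
  An antiderivative is \<open>ln (1 + exp (-s) u\<^sup>a)\<close>, continuous up to \<open>u = 0\<close> with value 0 there,
  although the integrand is unbounded at 0 when \<open>a < 1\<close>.
\<close>

lemma nn_integral_logistic:
  fixes a z s :: real
  assumes a: "a > 0" and z: "z > 0"
  shows "(\<integral>\<^sup>+u. ennreal (a / (u * (1 + exp (s - a * ln u)))) * indicator {0<..<z} u \<partial>lborel)
    = ennreal (ln (1 + exp (a * ln z - s)))"
proof -
  define G where "G = (\<lambda>u. ln (1 + exp (- s) * u powr a))"
  have "((\<lambda>u. a / (u * (1 + exp (s - a * ln u)))) has_integral (G z - G 0)) {0..z}"
  proof (rule fundamental_theorem_of_calculus_interior)
    have pos: "1 + exp (- s) * u powr a > 0" if "u \<in> {0..z}" for u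
      using that by (intro add_pos_nonneg) auto
    show "continuous_on {0..z} G"
      unfolding G_def using a pos
      by (intro continuous_intros continuous_on_powr') (auto simp: less_imp_neq[symmetric])
    fix u assume u: "u \<in> {0<..<z}"
    have e: "exp (s - a * ln u) = 1 / (exp (- s) * u powr a)"
      using u by (simp add: powr_def exp_diff exp_minus field_simps)
    have p: "exp (- s) * u powr a > 0" using u by simp
    have "(G has_real_derivative (exp (- s) * (a * u powr (a - 1))) / (1 + exp (- s) * u powr a)) (at u)"
      unfolding G_def using u p by (auto intro!: derivative_eq_intros simp: add_pos_pos)
    also have "(exp (- s) * (a * u powr (a - 1))) / (1 + exp (- s) * u powr a)
        = a / (u * (1 + exp (s - a * ln u)))"
      unfolding e using u p by (simp add: powr_diff field_simps)
    finally show "(G has_vector_derivative a / (u * (1 + exp (s - a * ln u)))) (at u)"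
      by (rule has_real_derivative_iff_has_vector_derivative[THEN iffD1])
  qed (use z in auto)
  moreover have "G z - G 0 = ln (1 + exp (a * ln z - s))"
    using z by (simp add: G_def powr_def exp_diff exp_minus field_simps)
  ultimately have "((\<lambda>u. a / (u * (1 + exp (s - a * ln u)))) has_integral
      ln (1 + exp (a * ln z - s))) {0<..<z}"
    by (simp add: has_integral_Icc_iff_Ioo)
  from nn_integral_has_integral_lebesgue'[OF _ this] show ?thesis
    using a by (simp add: add_nonneg_nonneg)
qed

text \<open>
  By \<open>wh_F_diff\<close> the exponent in the definition of \<open>\<phi>\<close> is \<open>- 1/(2\<pi>)\<close> times a double integral of
  a nonnegative function of \<open>(u, x)\<close>. The substitution \<open>x = a (t - ln u - v)\<close> with \<open>t = ln z\<close> moves the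
  dependence on \<open>u\<close> from the kernel to the logistic factor, and after exchanging the integrals the
  integral over \<open>u\<close> is elementary.
\<close>

lemma wh_phi_pos_eq:
  fixes a \<rho> z X :: real
  assumes a: "a > 0" and \<rho>: "0 < \<rho>" "\<rho> < 1" and z: "z > 0"
    and X: "(\<integral>\<^sup>+v. ennreal (strip_kernel (pi * \<rho>) (v - ln z) * ln (1 + exp (a * v))) \<partial>lborel) = ennreal X" "X \<ge> 0"
  shows "wh_phi_pos z a \<rho> = exp (- of_real (X / (2 * pi)))"
proof -
  define y where "y = pi * \<rho>"
  have y: "0 < y" "y < pi" using \<rho> by (simp_all add: y_def)
  define t where "t = ln z"
  define h where "h = strip_kernel y"
  have h0: "h v \<ge> 0" for v unfolding h_def by (rule strip_kernel_nonneg[OF y])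
  have [measurable]: "h \<in> borel_measurable borel" unfolding h_def by measurable
  define g where "g = (\<lambda>u. \<integral>x. h (ln u + x / a) / (1 + exp x) \<partial>lborel)"
  have w: "of_real pi * \<i> * of_real \<rho> - of_real (ln u) = Complex (- ln u) y"
    "- of_real pi * \<i> * of_real \<rho> - of_real (ln u) = Complex (- ln u) (- y)" for u
    by (simp_all add: complex_eq_iff y_def)
  have integrand: "indicator {0<..<z} u *\<^sub>R (1 / (2 * of_real pi * \<i> * of_real u) *
       (wh_F (of_real pi * \<i> * of_real \<rho> - of_real (ln u)) a
        - wh_F (- of_real pi * \<i> * of_real \<rho> - of_real (ln u)) a))
      = of_real (- (1 / (2 * pi)) * (indicator {0<..<z} u * (g u / u)))" for u
    unfolding w wh_F_diff(2)[OF a y] g_def h_def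
    by (simp add: scaleR_conv_of_real field_simps)
  have g_nn: "ennreal (g u) = (\<integral>\<^sup>+x. ennreal (h (ln u + x / a) / (1 + exp x)) \<partial>lborel)" for u
    unfolding g_def using wh_F_diff(1)[OF a y, of "ln u"] h0
    by (intro nn_integral_eq_integral[symmetric]) (auto simp: h_def add_nonneg_nonneg)
  have g0: "g u \<ge> 0" for u
    unfolding g_def using h0 by (intro integral_nonneg_AE AE_I2) (simp add: add_nonneg_nonneg)
  have g_subst: "ennreal (g u) = (\<integral>\<^sup>+v. ennreal (h (v - t) * (a / (1 + exp (a * (t - v) - a * ln u)))) \<partial>lborel)" for u
  proof -
    have "ennreal (g u) = \<bar>- a\<bar> * (\<integral>\<^sup>+v. ennreal (h (ln u + (a * (t - ln u) + (- a) * v) / a)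
        / (1 + exp (a * (t - ln u) + (- a) * v))) \<partial>lborel)"
      unfolding g_nn using a by (intro nn_integral_real_affine) auto
    also have "\<dots> = (\<integral>\<^sup>+v. ennreal a * ennreal (h (ln u + (a * (t - ln u) + (- a) * v) / a)
        / (1 + exp (a * (t - ln u) + (- a) * v))) \<partial>lborel)"
      using a by (subst nn_integral_cmult) auto
    also have "\<dots> = (\<integral>\<^sup>+v. ennreal (h (v - t) * (a / (1 + exp (a * (t - v) - a * ln u)))) \<partial>lborel)"
    proof (rule nn_integral_cong)
      fix v
      have "ln u + (a * (t - ln u) + (- a) * v) / a = - (v - t)" using a by (simp add: field_simps)
      then have "h (ln u + (a * (t - ln u) + (- a) * v) / a) = h (v - t)"
        by (simp only: h_def strip_kernel_even)
      moreover have "a * (t - ln u) + (- a) * v = a * (t - v) - a * ln u" by (simp add: algebra_simps)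
      ultimately show "ennreal a * ennreal (h (ln u + (a * (t - ln u) + (- a) * v) / a)
        / (1 + exp (a * (t - ln u) + (- a) * v)))
        = ennreal (h (v - t) * (a / (1 + exp (a * (t - v) - a * ln u))))"
        using a by (simp add: ennreal_mult'[symmetric] mult.commute)
    qed
    finally show ?thesis .
  qed
  define k where "k = (\<lambda>u v. a / (u * (1 + exp (a * (t - v) - a * ln u))))"
  have [measurable]: "(\<lambda>(u, v). k u v) \<in> borel_measurable (lborel \<Otimes>\<^sub>M lborel)"
    unfolding k_def by measurable
  have "(\<integral>\<^sup>+u. ennreal (indicator {0<..<z} u * (g u / u)) \<partial>lborel)
      = (\<integral>\<^sup>+u. (\<integral>\<^sup>+v. ennreal (h (v - t)) * (ennreal (k u v) * indicator {0<..<z} u) \<partial>lborel) \<partial>lborel)"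
  proof (rule nn_integral_cong)
    fix u
    show "ennreal (indicator {0<..<z} u * (g u / u))
        = (\<integral>\<^sup>+v. ennreal (h (v - t)) * (ennreal (k u v) * indicator {0<..<z} u) \<partial>lborel)"
    proof (cases "u \<in> {0<..<z}")
      case True
      then have "ennreal (indicator {0<..<z} u * (g u / u)) = ennreal (1 / u) * ennreal (g u)"
        using g0 by (simp add: ennreal_mult'[symmetric])
      also have "\<dots> = (\<integral>\<^sup>+v. ennreal (1 / u) *
          ennreal (h (v - t) * (a / (1 + exp (a * (t - v) - a * ln u)))) \<partial>lborel)"
        unfolding g_subst by (subst nn_integral_cmult) auto
      also have "\<dots> = (\<integral>\<^sup>+v. ennreal (h (v - t)) * (ennreal (k u v) * indicator {0<..<z} u) \<partial>lborel)"
        using True h0 a by (intro nn_integral_cong)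
          (simp add: k_def ennreal_mult'[symmetric] ac_simps)
      finally show ?thesis .
    qed auto
  qed
  also have "\<dots> = (\<integral>\<^sup>+v. (\<integral>\<^sup>+u. ennreal (h (v - t)) * (ennreal (k u v) * indicator {0<..<z} u) \<partial>lborel) \<partial>lborel)"
    by (rule lborel_pair.Fubini') measurable
  also have "\<dots> = (\<integral>\<^sup>+v. ennreal (h (v - t) * ln (1 + exp (a * v))) \<partial>lborel)"
  proof (rule nn_integral_cong)
    fix v
    have "(\<integral>\<^sup>+u. ennreal (h (v - t)) * (ennreal (k u v) * indicator {0<..<z} u) \<partial>lborel)
        = ennreal (h (v - t)) * (\<integral>\<^sup>+u. ennreal (k u v) * indicator {0<..<z} u \<partial>lborel)"
      by (rule nn_integral_cmult) measurable
    also have "(\<integral>\<^sup>+u. ennreal (k u v) * indicator {0<..<z} u \<partial>lborel) = ennreal (ln (1 + exp (a * v)))"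
      unfolding k_def nn_integral_logistic[OF a z] by (simp add: t_def algebra_simps)
    finally show "(\<integral>\<^sup>+u. ennreal (h (v - t)) * (ennreal (k u v) * indicator {0<..<z} u) \<partial>lborel)
        = ennreal (h (v - t) * ln (1 + exp (a * v)))"
      using h0 by (simp add: ennreal_mult'')
  qed
  finally have nn: "(\<integral>\<^sup>+u. ennreal (indicator {0<..<z} u * (g u / u)) \<partial>lborel) = ennreal X"
    using X(1) by (simp add: h_def y_def t_def)
  have gm: "g \<in> borel_measurable lborel"
    unfolding g_def by measurable
  have "(\<integral>u. indicator {0<..<z} u * (g u / u) \<partial>lborel)
      = enn2real (\<integral>\<^sup>+u. ennreal (indicator {0<..<z} u * (g u / u)) \<partial>lborel)"
    using g0 gm by (intro integral_eq_nn_integral AE_I2) (auto split: split_indicator)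
  also have "\<dots> = X" unfolding nn using X(2) by simp
  finally have "(\<integral>u. indicator {0<..<z} u * (g u / u) \<partial>lborel) = X" .
  then have "(LBINT u:{0<..<z}. 1 / (2 * of_real pi * \<i> * of_real u) *
       (wh_F (of_real pi * \<i> * of_real \<rho> - of_real (ln u)) a
        - wh_F (- of_real pi * \<i> * of_real \<rho> - of_real (ln u)) a))
      = of_real (- (1 / (2 * pi)) * X)"
    unfolding set_lebesgue_integral_def integrand
    by (simp only: integral_complex_of_real integral_mult_right_zero)
  then show ?thesis unfolding wh_phi_pos_def by simp
qed

text \<open>
  For a nonnegative function, convergence of the symmetric integrals is already absolute
  convergence, by monotone convergence.
\<close>

lemma nn_integral_eq_tendsto_symmetric:
  fixes g :: "real \<Rightarrow> real"
  assumes cont: "continuous_on UNIV g" and nonneg: "\<And>v. g v \<ge> 0"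
    and lim: "((\<lambda>T. integral {-T..T} (\<lambda>v. complex_of_real (g v))) \<longlongrightarrow> L) at_top"
  obtains X where "X \<ge> 0" "L = of_real X" "(\<integral>\<^sup>+v. ennreal (g v) \<partial>lborel) = ennreal X"
proof -
  have [measurable]: "g \<in> borel_measurable borel"
    using cont by (rule borel_measurable_continuous_onI)
  define J where "J = (\<lambda>T. integral {-T..T} g)"
  have int: "g integrable_on {-T..T}" for T
    by (intro integrable_continuous_real continuous_on_subset[OF cont]) auto
  then have Jc: "integral {-T..T} (\<lambda>v. complex_of_real (g v)) = of_real (J T)" for T
    unfolding J_def by (intro integral_unique has_integral_of_real integrable_integral)
  have "((\<lambda>n. complex_of_real (J (real n))) \<longlongrightarrow> L) sequentially"
    using filterlim_compose[OF lim filterlim_real_sequentially] unfolding Jc .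
  then have "(\<lambda>n. Re (complex_of_real (J (real n)))) \<longlonglongrightarrow> Re L"
    "(\<lambda>n. Im (complex_of_real (J (real n)))) \<longlonglongrightarrow> Im L"
    by (rule tendsto_Re, rule tendsto_Im)
  then have Jlim: "(\<lambda>n. J (real n)) \<longlonglongrightarrow> Re L" and "(\<lambda>n::nat. 0) \<longlonglongrightarrow> Im L"
    by simp_all
  then have im: "Im L = 0" using LIMSEQ_unique[OF _ tendsto_const] by blast
  have J0: "J T \<ge> 0" for T unfolding J_def by (intro integral_nonneg int nonneg)
  have pos: "Re L \<ge> 0" by (rule LIMSEQ_le_const[OF Jlim]) (use J0 in auto)
  define f where "f = (\<lambda>(n::nat) v. ennreal (g v) * indicator {- real n..real n} v)"
  have inc: "incseq f"
    by (auto simp: incseq_def le_fun_def f_def split: split_indicator)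
  have [measurable]: "f n \<in> borel_measurable lborel" for n unfolding f_def by measurable
  have fn: "(\<integral>\<^sup>+v. f n v \<partial>lborel) = ennreal (J (real n))" for n
    unfolding f_def J_def
    by (rule nn_integral_has_integral_lebesgue'[OF nonneg integrable_integral[OF int]])
  have sup: "(SUP n. f n v) = ennreal (g v)" for v
  proof (rule antisym)
    show "(SUP n. f n v) \<le> ennreal (g v)"
      by (rule SUP_least) (auto simp: f_def split: split_indicator)
    obtain n :: nat where "\<bar>v\<bar> \<le> real n" using real_arch_simple by blast
    then have "ennreal (g v) = f n v" by (simp add: f_def abs_le_iff)
    also have "\<dots> \<le> (SUP n. f n v)" by (rule SUP_upper) simp
    finally show "ennreal (g v) \<le> (SUP n. f n v)" .
  qed
  have "(\<integral>\<^sup>+v. ennreal (g v) \<partial>lborel) = (SUP n. (\<integral>\<^sup>+v. f n v \<partial>lborel))"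
    unfolding sup[symmetric] by (rule nn_integral_monotone_convergence_SUP[OF inc]) measurable
  also have "\<dots> = ennreal (Re L)"
  proof (rule LIMSEQ_unique[OF LIMSEQ_SUP])
    show "incseq (\<lambda>n. \<integral>\<^sup>+v. f n v \<partial>lborel)"
      using inc by (auto simp: incseq_def le_fun_def intro!: nn_integral_mono)
    show "(\<lambda>n. \<integral>\<^sup>+v. f n v \<partial>lborel) \<longlonglongrightarrow> ennreal (Re L)"
      unfolding fn by (intro tendsto_ennrealI Jlim)
  qed
  finally show thesis using that[OF pos] im by (simp add: complex_eq_iff)
qed

section \<open>The closed form on the positive half-line\<close>

lemma ln_Gamma_cnj:
  assumes z: "Re z > 0"
  shows "ln_Gamma (cnj z) = cnj (ln_Gamma z)"
proof -
  have log: "ln (cnj u) = cnj (ln u)" if "Re u > 0" for u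
    using cnj_Ln[OF Re_pos_not_nonpos_Reals[OF that]] by simp
  have ser: "ln_Gamma_series (cnj z) n = cnj (ln_Gamma_series z n)" if "n > 0" for n
  proof -
    have "ln (cnj z / of_nat k + 1) = cnj (ln (z / of_nat k + 1))" for k :: nat
      using log[of "z / of_nat k + 1"] z by (cases "k = 0") (auto simp: add_pos_pos)
    moreover have "ln (of_nat n) = cnj (ln (of_nat n))"
      using log[of "of_nat n"] that by simp
    ultimately show ?thesis using z log[of z]
      by (simp add: ln_Gamma_series_def)
  qed
  have "(\<lambda>n. cnj (ln_Gamma_series z n)) \<longlonglongrightarrow> cnj (ln_Gamma z)"
    by (intro tendsto_intros ln_Gamma_complex_LIMSEQ Re_pos_not_nonpos_Ints z)
  moreover have "ln_Gamma_series (cnj z) \<longlonglongrightarrow> ln_Gamma (cnj z)"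
    using z by (intro ln_Gamma_complex_LIMSEQ Re_pos_not_nonpos_Ints) simp
  then have "(\<lambda>n. cnj (ln_Gamma_series z n)) \<longlonglongrightarrow> ln_Gamma (cnj z)"
    by (rule Lim_transform_eventually)
      (use eventually_gt_at_top[of 0] in \<open>eventually_elim, simp add: ser\<close>)
  ultimately show ?thesis using LIMSEQ_unique by blast
qed

text \<open>
  The two summands are conjugate, so the sum is real and is determined by its exponential, which
  the reflection formula evaluates. This avoids any ambiguity by multiples of \<open>2\<pi>i\<close>.
\<close>

lemma ln_Gamma_critical_line:
  fixes x :: real
  shows "ln_Gamma (Complex (1/2) x) + ln_Gamma (Complex (1/2) (- x)) = of_real (ln (pi / cosh (pi * x)))"
proof -
  let ?z = "Complex (1/2) x"
  define R where "R = 2 * Re (ln_Gamma ?z)"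
  have cn: "Complex (1/2) (- x) = cnj ?z" by (simp add: complex_eq_iff)
  have sum: "ln_Gamma ?z + ln_Gamma (Complex (1/2) (- x)) = of_real R"
    unfolding cn by (subst ln_Gamma_cnj) (simp_all add: complex_add_cnj R_def)
  have "exp (complex_of_real R) = Gamma ?z * Gamma (1 - ?z)"
  proof -
    have "1 - ?z = Complex (1/2) (- x)" by (simp add: complex_eq_iff)
    then show ?thesis
      unfolding sum[symmetric] exp_add by (simp add: Gamma_complex_altdef Re_pos_not_nonpos_Ints)
  qed
  also have "\<dots> = of_real pi / sin (of_real pi * ?z)" by (rule Gamma_reflection_complex)
  also have "sin (of_real pi * ?z) = of_real (cosh (pi * x))"
  proof -
    have "of_real pi * ?z = of_real pi / 2 + \<i> * of_real (pi * x)" by (simp add: complex_eq_iff)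
    then have "sin (of_real pi * ?z) = cosh (complex_of_real (pi * x))"
      by (simp add: sin_add cosh_conv_cos)
    also have "\<dots> = of_real (cosh (pi * x))"
      by (simp add: cosh_def scaleR_conv_of_real flip: exp_of_real)
    finally show ?thesis .
  qed
  finally have "complex_of_real (exp R) = of_real (pi / cosh (pi * x))" by (simp add: exp_of_real)
  then have "exp R = pi / cosh (pi * x)" by (simp only: of_real_eq_iff)
  then have "R = ln (pi / cosh (pi * x))" by (metis ln_exp)
  then show ?thesis using sum by simp
qed

text \<open>
  The linear and quadratic terms account for the factor \<open>(2\<pi>\<surd>z)^(-\<alpha>\<rho>)\<close>, whose logarithm
  \<open>-\<alpha>\<rho> (ln (2\<pi>) + t/2)\<close> is of the form \<open>q \<omega> - q (cnj \<omega>)\<close> for a quadratic polynomial \<open>q\<close>.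
\<close>

definition wh_potential :: "real \<Rightarrow> complex \<Rightarrow> complex" where
  "wh_potential a v =
    log_barnes a (1/2 + of_real a / 2 - \<i> * of_real a * v / (2 * of_real pi))
    - log_barnes a (1/2 + of_real a / 2 + \<i> * of_real a * v / (2 * of_real pi))
    + \<i> * of_real a / (8 * of_real pi) * v\<^sup>2 + \<i> * of_real (a * ln (2 * pi)) / (2 * of_real pi) * v"

lemma Re_barnes_argument:
  "Re (1/2 + of_real a / 2 - \<i> * of_real a * v / (2 * of_real pi)) = 1/2 + a/2 + a * Im v / (2 * pi)"
  "Re (1/2 + of_real a / 2 + \<i> * of_real a * v / (2 * of_real pi)) = 1/2 + a/2 - a * Im v / (2 * pi)"
proof -
  have "\<i> * of_real a * v / (2 * of_real pi) = \<i> * of_real (a / (2 * pi)) * v" by simp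
  moreover have "Re (\<i> * of_real (a / (2 * pi)) * v) = - (a * Im v / (2 * pi))" by simp
  ultimately have "Re (\<i> * of_real a * v / (2 * of_real pi)) = - (a * Im v / (2 * pi))" by (simp only:)
  then show "Re (1/2 + of_real a / 2 - \<i> * of_real a * v / (2 * of_real pi)) = 1/2 + a/2 + a * Im v / (2 * pi)"
    "Re (1/2 + of_real a / 2 + \<i> * of_real a * v / (2 * of_real pi)) = 1/2 + a/2 - a * Im v / (2 * pi)"
    by (simp_all only: minus_complex.sel plus_complex.sel) simp_all
qed

text \<open>
  At \<open>\<bar>Im v\<bar> = \<pi>\<close> the arguments of \<open>log G\<close> still have real part at least \<open>1/2\<close>, which leaves
  room for a wider strip.
\<close>

lemma holomorphic_wh_potential:
  assumes a: "a > 0"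
  shows "wh_potential a holomorphic_on {v. \<bar>Im v\<bar> < pi * (1 + 1 / a)}"
proof -
  have bnd: "\<bar>a * Im v / (2 * pi)\<bar> < 1/2 + a/2" if "\<bar>Im v\<bar> < pi * (1 + 1 / a)" for v
  proof -
    have "\<bar>a * Im v / (2 * pi)\<bar> = a * \<bar>Im v\<bar> / (2 * pi)" using a by (simp add: abs_mult)
    also have "\<dots> < a * (pi * (1 + 1 / a)) / (2 * pi)"
      using that a by (intro divide_strict_right_mono mult_strict_left_mono) auto
    also have "\<dots> = 1/2 + a/2" using a by (simp add: field_simps)
    finally show ?thesis .
  qed
  have "(\<lambda>v. log_barnes a (1/2 + of_real a / 2 - \<i> * of_real a * v / (2 * of_real pi)))
      holomorphic_on {v. \<bar>Im v\<bar> < pi * (1 + 1 / a)}"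
  proof (rule holomorphic_on_compose_gen[OF _ holomorphic_log_barnes[OF a], unfolded o_def])
    show "(\<lambda>v. 1/2 + of_real a / 2 - \<i> * of_real a * v / (2 * of_real pi)) `
        {v. \<bar>Im v\<bar> < pi * (1 + 1 / a)} \<subseteq> {z. Re z > 0}"
      unfolding image_subset_iff mem_Collect_eq Re_barnes_argument
      by (intro ballI) (drule CollectD, drule bnd, unfold abs_less_iff, linarith)
  qed (auto intro!: holomorphic_intros)
  moreover have "(\<lambda>v. log_barnes a (1/2 + of_real a / 2 + \<i> * of_real a * v / (2 * of_real pi)))
      holomorphic_on {v. \<bar>Im v\<bar> < pi * (1 + 1 / a)}"
  proof (rule holomorphic_on_compose_gen[OF _ holomorphic_log_barnes[OF a], unfolded o_def])
    show "(\<lambda>v. 1/2 + of_real a / 2 + \<i> * of_real a * v / (2 * of_real pi)) `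
        {v. \<bar>Im v\<bar> < pi * (1 + 1 / a)} \<subseteq> {z. Re z > 0}"
      unfolding image_subset_iff mem_Collect_eq Re_barnes_argument
      by (intro ballI) (drule CollectD, drule bnd, unfold abs_less_iff, linarith)
  qed (auto intro!: holomorphic_intros)
  ultimately show ?thesis
    unfolding wh_potential_def[abs_def] by (intro holomorphic_intros) auto
qed

lemma wh_potential_growth:
  assumes a: "a > 0"
  obtains A where "\<And>v. \<bar>Im v\<bar> \<le> pi \<Longrightarrow> norm (wh_potential a v) \<le> A * (1 + norm v) ^ 3"
proof -
  obtain B where B: "\<And>z. Re z \<ge> 1/2 \<Longrightarrow> norm (log_barnes a z) \<le> B * (1 + norm z) ^ 3"
    using log_barnes_growth[OF a] by blast
  define M where "M = 2 + a"
  have "norm (wh_potential a v) \<le> (2 * \<bar>B\<bar> * M ^ 3 + a + a * \<bar>ln (2 * pi)\<bar>) * (1 + norm v) ^ 3"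
    if v: "\<bar>Im v\<bar> \<le> pi" for v
  proof -
    define R where "R = 1 + norm v"
    have R: "R \<ge> 1" by (simp add: R_def)
    have R3: "R \<le> R ^ 3" "R ^ 2 \<le> R ^ 3"
      using R power_increasing[of 1 3 R] power_increasing[of 2 3 R] by auto
    define s where "s = \<i> * of_real a * v / (2 * of_real pi)"
    have ns: "norm s \<le> a / 2 * norm v"
    proof -
      have "norm s = a * norm v / (2 * pi)" using a by (simp add: s_def norm_mult norm_divide)
      also have "\<dots> \<le> a * norm v / 2" using a pi_gt3 by (intro divide_left_mono) auto
      finally show ?thesis by simp
    qed
    have "\<bar>a * Im v / (2 * pi)\<bar> = a * \<bar>Im v\<bar> / (2 * pi)" using a by (simp add: abs_mult)
    also have "\<dots> \<le> a * pi / (2 * pi)" using v a by (intro divide_right_mono mult_left_mono) auto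
    finally have im: "\<bar>a * Im v / (2 * pi)\<bar> \<le> a / 2" by simp
    have re: "Re (1/2 + of_real a / 2 - s) \<ge> 1/2" "Re (1/2 + of_real a / 2 + s) \<ge> 1/2"
      unfolding s_def Re_barnes_argument using im by linarith+
    have c: "norm (1/2 + complex_of_real a / 2) \<le> 1/2 + a/2"
    proof -
      have "1/2 + complex_of_real a / 2 = of_real (1/2 + a/2)" by simp
      then show ?thesis using a by (simp only: norm_of_real)
    qed
    have bound: "norm (log_barnes a z) \<le> \<bar>B\<bar> * M ^ 3 * R ^ 3"
      if "z = 1/2 + of_real a / 2 - s \<or> z = 1/2 + of_real a / 2 + s" for z
    proof -
      have "norm z \<le> norm (1/2 + complex_of_real a / 2) + norm s"
        using that norm_triangle_ineq norm_triangle_ineq4 by blast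
      also have "\<dots> \<le> 1/2 + a/2 + a/2 * norm v" using c ns by simp
      finally have "1 + norm z \<le> 3/2 + a/2 + a/2 * norm v" by simp
      also have "\<dots> \<le> M * R"
        using a mult_nonneg_nonneg[of a "norm v"] norm_ge_zero[of v]
        unfolding M_def R_def distrib_left distrib_right mult_1_left mult_1_right by linarith
      finally have le: "1 + norm z \<le> M * R" .
      have "norm (log_barnes a z) \<le> B * (1 + norm z) ^ 3" using B re that by blast
      also have "\<dots> \<le> \<bar>B\<bar> * (M * R) ^ 3" using le by (intro mult_mono power_mono) auto
      finally show ?thesis by (simp add: power_mult_distrib mult_ac)
    qed
    have quad: "norm (\<i> * of_real a / (8 * of_real pi) * v\<^sup>2) \<le> a * R ^ 3"
    proof -
      have "norm (\<i> * of_real a / (8 * of_real pi) * v\<^sup>2) = a / (8 * pi) * (norm v)\<^sup>2"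
        using a by (simp add: norm_mult norm_divide norm_power)
      also have "\<dots> \<le> a / 1 * R\<^sup>2"
        using a pi_gt3 by (intro mult_mono frac_le power_mono) (auto simp: R_def)
      also have "\<dots> \<le> a * R ^ 3" using a R3 by simp
      finally show ?thesis .
    qed
    have lin: "norm (\<i> * of_real (a * ln (2 * pi)) / (2 * of_real pi) * v) \<le> a * \<bar>ln (2 * pi)\<bar> * R ^ 3"
    proof -
      have "norm (\<i> * of_real (a * ln (2 * pi)) / (2 * of_real pi) * v)
          = (a * \<bar>ln (2 * pi)\<bar>) / (2 * pi) * norm v"
        using a by (simp add: norm_mult norm_divide abs_mult)
      also have "\<dots> \<le> (a * \<bar>ln (2 * pi)\<bar>) / 1 * R"
        using a pi_gt3 by (intro mult_mono frac_le) (auto simp: R_def)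
      also have "\<dots> \<le> a * \<bar>ln (2 * pi)\<bar> * R ^ 3"
        using a R3 mult_left_mono[of R "R ^ 3" "a * \<bar>ln (2 * pi)\<bar>"] by simp
      finally show ?thesis .
    qed
    have tri: "norm (p - q + r + u) \<le> norm p + norm q + norm r + norm u" for p q r u :: complex
      using norm_triangle_ineq[of "p - q + r" u] norm_triangle_ineq[of "p - q" r]
        norm_triangle_ineq4[of p q] by linarith
    have "norm (wh_potential a v) \<le> \<bar>B\<bar> * M ^ 3 * R ^ 3 + \<bar>B\<bar> * M ^ 3 * R ^ 3 + a * R ^ 3
        + a * \<bar>ln (2 * pi)\<bar> * R ^ 3"
      unfolding wh_potential_def s_def[symmetric]
      using bound quad lin by (intro order_trans[OF tri] add_mono) auto
    then show ?thesis by (simp add: R_def algebra_simps)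
  qed
  then show thesis by (rule that)
qed

text \<open>
  The four arguments of \<open>log G\<close> form two pairs \<open>(s + a, s)\<close> with \<open>s = 1/2 + ix\<close> and
  \<open>s = 1/2 - ix\<close>. The quasi-period relation applies to each pair; the factors
  \<open>a^(1/2-s)\<close> cancel, and the Gamma values combine to \<open>\<pi> / cosh (\<pi>x)\<close>.
\<close>

lemma wh_potential_jump:
  assumes a: "a > 0"
  shows "wh_potential a (Complex v pi) - wh_potential a (Complex v (- pi)) = - of_real (ln (1 + exp (a * v)))"
proof -
  define x where "x = - (a * v / (2 * pi))"
  have s: "\<i> * of_real a * Complex v pi / (2 * of_real pi) = Complex (- a / 2) (- x)"
    "\<i> * of_real a * Complex v (- pi) / (2 * of_real pi) = Complex (a / 2) (- x)"
    by (simp_all add: complex_eq_iff x_def Re_divide Im_divide power2_eq_square)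
  have arg: "1/2 + of_real a / 2 - Complex (- a / 2) (- x) = Complex (1/2) x + of_real a"
    "1/2 + of_real a / 2 + Complex (- a / 2) (- x) = Complex (1/2) (- x)"
    "1/2 + of_real a / 2 - Complex (a / 2) (- x) = Complex (1/2) x"
    "1/2 + of_real a / 2 + Complex (a / 2) (- x) = Complex (1/2) (- x) + of_real a"
    by (simp_all add: complex_eq_iff)
  have sq: "(Complex v pi)\<^sup>2 - (Complex v (- pi))\<^sup>2 = \<i> * of_real (4 * pi * v)"
    "Complex v pi - Complex v (- pi) = \<i> * of_real (2 * pi)"
    by (simp_all add: complex_eq_iff power2_eq_square)
  have quad: "\<i> * of_real a / (8 * of_real pi) * (Complex v pi)\<^sup>2
      - \<i> * of_real a / (8 * of_real pi) * (Complex v (- pi))\<^sup>2 = - of_real (a * v / 2)"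
    unfolding right_diff_distrib[symmetric] sq by simp
  have lin: "\<i> * of_real (a * ln (2 * pi)) / (2 * of_real pi) * Complex v pi
      - \<i> * of_real (a * ln (2 * pi)) / (2 * of_real pi) * Complex v (- pi) = - of_real (a * ln (2 * pi))"
    unfolding right_diff_distrib[symmetric] sq by (simp add: complex_eq_iff)
  define p where "p = log_barnes a (Complex (1/2) x + of_real a) - log_barnes a (Complex (1/2) x)"
  define q where "q = log_barnes a (Complex (1/2) (- x) + of_real a) - log_barnes a (Complex (1/2) (- x))"
  have pq: "p + q = of_real (ln (pi / cosh (pi * x))) + of_real ((a - 1) * ln (2 * pi))"
  proof -
    have "(1/2 - Complex (1/2) x) * of_real (ln a) + (1/2 - Complex (1/2) (- x)) * of_real (ln a) = 0"
      by (simp add: complex_eq_iff)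
    moreover have "p + q = (ln_Gamma (Complex (1/2) x) + ln_Gamma (Complex (1/2) (- x)))
        + of_real ((a - 1) / 2 * ln (2 * pi)) + of_real ((a - 1) / 2 * ln (2 * pi))
        + ((1/2 - Complex (1/2) x) * of_real (ln a) + (1/2 - Complex (1/2) (- x)) * of_real (ln a))"
      unfolding p_def q_def by (subst log_barnes_shift[OF a], simp)+ simp
    ultimately show ?thesis
      unfolding ln_Gamma_critical_line by (simp flip: of_real_add)
  qed
  have "wh_potential a (Complex v pi) - wh_potential a (Complex v (- pi))
      = p + q + (\<i> * of_real a / (8 * of_real pi) * (Complex v pi)\<^sup>2
        - \<i> * of_real a / (8 * of_real pi) * (Complex v (- pi))\<^sup>2)
      + (\<i> * of_real (a * ln (2 * pi)) / (2 * of_real pi) * Complex v pi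
        - \<i> * of_real (a * ln (2 * pi)) / (2 * of_real pi) * Complex v (- pi))"
    unfolding wh_potential_def s arg p_def q_def by simp
  also have "\<dots> = of_real (ln (pi / cosh (pi * x)) - ln (2 * pi) - a * v / 2)"
    unfolding pq quad lin by (simp add: algebra_simps)
  also have "ln (pi / cosh (pi * x)) - ln (2 * pi) - a * v / 2 = - ln (1 + exp (a * v))"
  proof -
    have ch: "cosh (pi * x) = cosh (a * v / 2)" by (simp add: x_def)
    have e: "1 + exp (a * v) = 2 * cosh (a * v / 2) * exp (a * v / 2)"
    proof -
      have "2 * cosh (a * v / 2) * exp (a * v / 2) = exp (a * v / 2 + a * v / 2) + exp (- (a * v / 2) + a * v / 2)"
        unfolding exp_add by (simp add: cosh_def algebra_simps)
      then show ?thesis by simp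
    qed
    have "cosh (a * v / 2) > 0" by (rule cosh_real_pos)
    then show ?thesis
      unfolding ch e by (simp add: ln_div ln_mult)
  qed
  finally show ?thesis by simp
qed

definition wh_closed_form :: "real \<Rightarrow> real \<Rightarrow> complex \<Rightarrow> complex" where
  "wh_closed_form \<alpha> \<rho> z =
    (2 * of_real pi * csqrt z) powr (- of_real (\<alpha> * \<rho>)) *
    (barnes_G (1/2 + of_real \<alpha> / 2 * (1 + of_real \<rho> + ln z / (of_real pi * \<i>))) (of_real \<alpha>) /
     barnes_G (1/2 + of_real \<alpha> / 2 * (1 - of_real \<rho> + ln z / (of_real pi * \<i>))) (of_real \<alpha>)) *
    (barnes_G (1/2 + of_real \<alpha> / 2 * (1 + of_real \<rho> - ln z / (of_real pi * \<i>))) (of_real \<alpha>) /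
     barnes_G (1/2 + of_real \<alpha> / 2 * (1 - of_real \<rho> - ln z / (of_real pi * \<i>))) (of_real \<alpha>))"

lemma wh_closed_form_of_real:
  fixes a \<rho> x :: real
  assumes a: "a > 0" and \<rho>: "0 < \<rho>" "\<rho> < 1" and x: "x > 0"
  shows "wh_closed_form a \<rho> (of_real x)
    = exp (wh_potential a (Complex (ln x) (pi * \<rho>)) - wh_potential a (Complex (ln x) (- (pi * \<rho>))))"
proof -
  define t where "t = ln x"
  define w w' where "w = Complex t (pi * \<rho>)" and "w' = Complex t (- (pi * \<rho>))"
  define c where "c = 1/2 + complex_of_real a / 2"
  define m where "m = (\<lambda>v. \<i> * of_real a * v / (2 * of_real pi))"
  have lnx: "ln (complex_of_real x) = of_real t" using x by (simp add: Ln_of_real t_def)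
  have w_eq: "w = of_real t + \<i> * of_real (pi * \<rho>)" "w' = of_real t - \<i> * of_real (pi * \<rho>)"
    by (simp_all add: complex_eq_iff w_def w'_def)
  have args: "1/2 + of_real a / 2 * (1 + of_real \<rho> + of_real t / (of_real pi * \<i>)) = c - m w"
    "1/2 + of_real a / 2 * (1 - of_real \<rho> + of_real t / (of_real pi * \<i>)) = c - m w'"
    "1/2 + of_real a / 2 * (1 + of_real \<rho> - of_real t / (of_real pi * \<i>)) = c + m w'"
    "1/2 + of_real a / 2 * (1 - of_real \<rho> - of_real t / (of_real pi * \<i>)) = c + m w"
    by (simp_all add: c_def m_def w_eq divide_simps) (simp_all add: algebra_simps)
  have small: "a * (pi * \<rho>) / (2 * pi) < a / 2" "0 < a * (pi * \<rho>) / (2 * pi)"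
    using a \<rho> by simp_all
  have re: "Re (c - m w) > 0" "Re (c - m w') > 0" "Re (c + m w') > 0" "Re (c + m w) > 0"
    unfolding c_def m_def Re_barnes_argument w_def w'_def complex.sel using small a by linarith+
  have pow: "(2 * of_real pi * csqrt (of_real x)) powr (- of_real (a * \<rho>))
      = exp (- of_real (a * \<rho> * (ln (2 * pi) + t / 2)))"
  proof -
    have "2 * of_real pi * csqrt (of_real x) = complex_of_real (2 * pi * sqrt x)"
      using x by (simp add: csqrt_of_real_nonneg)
    moreover have "ln (complex_of_real (2 * pi * sqrt x)) = of_real (ln (2 * pi * sqrt x))"
      using x by (intro Ln_of_real) simp
    moreover have "ln (2 * pi * sqrt x) = ln (2 * pi) + t / 2"
      using x by (simp add: ln_mult ln_sqrt t_def)
    moreover have "complex_of_real (2 * pi * sqrt x) \<noteq> 0" using x by simp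
    ultimately show ?thesis by (simp add: powr_def)
  qed
  have quad: "\<i> * of_real a / (8 * of_real pi) * w\<^sup>2 - \<i> * of_real a / (8 * of_real pi) * w'\<^sup>2
      = - of_real (a * \<rho> * t / 2)"
  proof -
    have "w\<^sup>2 - w'\<^sup>2 = \<i> * of_real (4 * pi * \<rho> * t)"
      by (simp add: w_eq power2_eq_square algebra_simps)
    then show ?thesis unfolding right_diff_distrib[symmetric] by simp
  qed
  have lin: "\<i> * of_real (a * ln (2 * pi)) / (2 * of_real pi) * w
      - \<i> * of_real (a * ln (2 * pi)) / (2 * of_real pi) * w' = - of_real (a * \<rho> * ln (2 * pi))"
  proof -
    have "w - w' = \<i> * of_real (2 * pi * \<rho>)" by (simp add: w_eq)
    then show ?thesis unfolding right_diff_distrib[symmetric] by (simp add: complex_eq_iff)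
  qed
  have "wh_potential a w - wh_potential a w' =
      (log_barnes a (c - m w) - log_barnes a (c - m w')) + (log_barnes a (c + m w') - log_barnes a (c + m w))
      + (\<i> * of_real a / (8 * of_real pi) * w\<^sup>2 - \<i> * of_real a / (8 * of_real pi) * w'\<^sup>2)
      + (\<i> * of_real (a * ln (2 * pi)) / (2 * of_real pi) * w
      - \<i> * of_real (a * ln (2 * pi)) / (2 * of_real pi) * w')"
    unfolding wh_potential_def c_def m_def by simp
  also have "\<dots> = - of_real (a * \<rho> * (ln (2 * pi) + t / 2))
      + (log_barnes a (c - m w) - log_barnes a (c - m w')) + (log_barnes a (c + m w') - log_barnes a (c + m w))"
    unfolding quad lin by (simp add: algebra_simps)
  finally have "exp (wh_potential a w - wh_potential a w')
      = exp (- of_real (a * \<rho> * (ln (2 * pi) + t / 2)))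
      * (exp (log_barnes a (c - m w)) / exp (log_barnes a (c - m w')))
      * (exp (log_barnes a (c + m w')) / exp (log_barnes a (c + m w)))"
    by (simp only: exp_add exp_diff)
  then show ?thesis
    unfolding wh_closed_form_def lnx args pow re[THEN barnes_G_eq_exp_log_barnes[OF a]]
    by (simp add: w_def w'_def t_def)
qed

lemma wh_phi_pos_eq_closed_form:
  fixes a \<rho> x :: real
  assumes a: "a > 0" and \<rho>: "0 < \<rho>" "\<rho> < 1" and x: "x > 0"
  shows "wh_phi_pos x a \<rho> = wh_closed_form a \<rho> (of_real x)"
proof -
  define y where "y = pi * \<rho>"
  have y: "0 < y" "y < pi" using \<rho> by (simp_all add: y_def)
  define t where "t = ln x"
  obtain A where A: "\<And>v. \<bar>Im v\<bar> \<le> pi \<Longrightarrow> norm (wh_potential a v) \<le> A * (1 + norm v) ^ 3"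
    using wh_potential_growth[OF a] by blast
  let ?g = "\<lambda>v. strip_kernel y (v - t) * ln (1 + exp (a * v))"
  have lim: "((\<lambda>T. integral {-T..T} (\<lambda>v. complex_of_real (?g v)))
      \<longlongrightarrow> - 2 * of_real pi * (wh_potential a (Complex t y) - wh_potential a (Complex t (- y)))) at_top"
    by (rule strip_difference_formula[OF _ holomorphic_wh_potential[OF a] A wh_potential_jump[OF a] y])
      (use a in \<open>simp_all add: field_simps\<close>)
  have "cosh (v - t) + cos y \<noteq> 0" "1 + exp (a * v) \<noteq> 0" for v
    using strip_kernel_denom_pos[OF y, of "v - t"] exp_gt_zero[of "a * v"] by linarith+
  then have "continuous_on UNIV ?g"
    unfolding strip_kernel_def by (intro continuous_intros ballI)
  moreover have "?g v \<ge> 0" for v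
    using strip_kernel_nonneg[OF y] by (intro mult_nonneg_nonneg) auto
  ultimately obtain X where X: "X \<ge> 0"
    "- 2 * of_real pi * (wh_potential a (Complex t y) - wh_potential a (Complex t (- y))) = of_real X"
    "(\<integral>\<^sup>+v. ennreal (?g v) \<partial>lborel) = ennreal X"
    using nn_integral_eq_tendsto_symmetric[OF _ _ lim] by blast
  have "wh_phi_pos x a \<rho> = exp (- of_real (X / (2 * pi)))"
    using X(1,3) by (intro wh_phi_pos_eq a \<rho> x) (simp_all add: y_def t_def)
  also have "- complex_of_real (X / (2 * pi)) = wh_potential a (Complex t y) - wh_potential a (Complex t (- y))"
    unfolding of_real_divide X(2)[symmetric] by simp
  finally show ?thesis
    using wh_closed_form_of_real[OF a \<rho> x] by (simp add: t_def y_def)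
qed

section \<open>Continuation to the slit plane\<close>

lemma barnes_G_nonzero:
  assumes "\<tau> > 0" "Re z > 0"
  shows "barnes_G z (of_real \<tau>) \<noteq> 0"
  using barnes_G_eq_exp_log_barnes[OF assms] by simp

text \<open>
  On the slit plane \<open>\<bar>Re (ln z / (\<pi>i))\<bar> < 1\<close>, so the arguments in the numerators have positive
  real part and the numerators do not vanish. The function is therefore the reciprocal of a
  holomorphic one; as \<open>inverse 0 = 0\<close>, it has the value 0 at its poles.
\<close>

lemma nicely_meromorphic_wh_closed_form:
  fixes a \<rho> :: real
  assumes a: "a > 0" and \<rho>: "0 < \<rho>" "\<rho> < 1"
  shows "wh_closed_form a \<rho> nicely_meromorphic_on (- \<real>\<^sub>\<le>\<^sub>0)"
proof -
  let ?D = "- \<real>\<^sub>\<le>\<^sub>0 :: complex set"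
  define w where "w = (\<lambda>z. ln z / (of_real pi * \<i>))"
  define P where "P = (\<lambda>z. (2 * of_real pi * csqrt z) powr (- of_real (a * \<rho>)))"
  define G where "G = (\<lambda>s v. barnes_G (1/2 + of_real a / 2 * (1 + of_real s + v)) (of_real a))"
  have w: "w holomorphic_on ?D" unfolding w_def by (intro holomorphic_intros) auto
  have G: "(\<lambda>z. G s (w z)) holomorphic_on ?D" "(\<lambda>z. G s (- w z)) holomorphic_on ?D" for s
    unfolding G_def
    by (rule holomorphic_on_compose_gen[OF _ entire_barnes_G[OF a], unfolded o_def];
        auto intro!: holomorphic_intros w)+
  have csq: "2 * of_real pi * csqrt z \<notin> \<real>\<^sub>\<le>\<^sub>0" if "z \<in> ?D" for z
  proof (rule Re_pos_not_nonpos_Reals)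
    have "Re (csqrt z) \<noteq> 0"
    proof
      assume "Re (csqrt z) = 0"
      then have "(csqrt z)\<^sup>2 = - of_real ((Im (csqrt z))\<^sup>2)"
        by (simp add: complex_eq_iff power2_eq_square)
      then have "z = of_real (- ((Im (csqrt z))\<^sup>2))" by simp
      then have "z \<in> \<real>\<^sub>\<le>\<^sub>0" by (metis nonpos_Reals_of_real_iff neg_le_0_iff_le zero_le_power2)
      with that show False by simp
    qed
    then have "Re (csqrt z) > 0" using Re_csqrt[of z] by linarith
    then show "0 < Re (2 * of_real pi * csqrt z)" by simp
  qed
  have P: "P holomorphic_on ?D" unfolding P_def using csq by (intro holomorphic_intros) auto
  have P0: "P z \<noteq> 0" if "z \<in> ?D" for z
    using csq[OF that] that by (auto simp: P_def)
  have Rew: "\<bar>Re (w z)\<bar> < 1" if "z \<in> ?D" for z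
  proof -
    have "z \<noteq> 0" using that by auto
    then have "\<bar>Im (ln z)\<bar> < pi"
 using that Im_Ln_less_pi[of z] mpi_less_Im_Ln[of z] by auto
    moreover have "Re (w z) = Im (ln z) / pi"
      by (simp add: w_def Re_divide power2_eq_square)
    ultimately show ?thesis by simp
  qed
  have num: "G \<rho> (w z) \<noteq> 0" "G \<rho> (- w z) \<noteq> 0" if "z \<in> ?D" for z
  proof -
    have "0 < a / 2 * (1 + \<rho> + Re (w z))" "0 < a / 2 * (1 + \<rho> - Re (w z))"
      using Rew[OF that] \<rho> a by (intro mult_pos_pos; linarith)+
    then show "G \<rho> (w z) \<noteq> 0" "G \<rho> (- w z) \<noteq> 0"
      unfolding G_def by (intro barnes_G_nonzero a; simp)+
  qed
  have "(\<lambda>z. (G (- \<rho>) (w z) * G (- \<rho>) (- w z)) / (P z * G \<rho> (w z) * G \<rho> (- w z))) holomorphic_on ?D"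
    using P0 num by (intro holomorphic_intros G P) auto
  then have "(\<lambda>z. (G (- \<rho>) (w z) * G (- \<rho>) (- w z)) / (P z * G \<rho> (w z) * G \<rho> (- w z)))
      nicely_meromorphic_on ?D"
    by (intro analytic_on_imp_nicely_meromorphic_on) (simp add: analytic_on_open closed_nonpos_Reals_complex open_Compl)
  from nicely_meromorphic_on_inverse[OF this]
  have "(\<lambda>z. inverse ((G (- \<rho>) (w z) * G (- \<rho>) (- w z)) / (P z * G \<rho> (w z) * G \<rho> (- w z))))
      nicely_meromorphic_on ?D" .
  also have "(\<lambda>z. inverse ((G (- \<rho>) (w z) * G (- \<rho>) (- w z)) / (P z * G \<rho> (w z) * G \<rho> (- w z))))
      = wh_closed_form a \<rho>"
    by (intro ext) (simp add: wh_closed_form_def P_def G_def w_def)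
  finally show ?thesis .
qed

text \<open>
  The difference is meromorphic and hence vanishes off a sparse set. At an exceptional point the
  two functions have the same germ, so either both are continuous there or both have a pole and
  the conventional value 0.
\<close>

lemma nicely_meromorphic_identity:
  assumes f: "f nicely_meromorphic_on A" and g: "g nicely_meromorphic_on A"
    and A: "open A" "connected A" and x: "x \<in> A" and freq: "frequently (\<lambda>z. f z = g z) (at x)"
    and z: "z \<in> A"
  shows "f z = g z"
proof -
  have "(\<lambda>z. f z - g z) meromorphic_on A"
    using f g by (auto intro!: meromorphic_intros simp: nicely_meromorphic_on_def)
  then have "eventually (\<lambda>z. f z - g z = 0) (cosparse A) \<or> eventually (\<lambda>z. f z - g z \<noteq> 0) (cosparse A)"
    by (rule meromorphic_imp_constant_or_avoid[OF _ A])
  moreover have "\<not> eventually (\<lambda>z. f z - g z \<noteq> 0) (cosparse A)"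
  proof
    assume "eventually (\<lambda>z. f z - g z \<noteq> 0) (cosparse A)"
    then have "eventually (\<lambda>z. f z - g z \<noteq> 0) (at x)"
      using eventually_cosparse_open_eq[OF A(1)] x by blast
    then show False using freq by (simp add: frequently_def)
  qed
  ultimately have "eventually (\<lambda>z. f z - g z = 0) (at z)"
    using eventually_cosparse_open_eq[OF A(1)] z by blast
  then have ev: "eventually (\<lambda>z. f z = g z) (at z)" by simp
  have pole: "is_pole f z \<longleftrightarrow> is_pole g z" by (rule is_pole_cong[OF ev refl])
  show ?thesis
  proof (cases "is_pole f z")
    case True
    then show ?thesis
      using pole is_pole_zero_at_nicely_mero[OF f _ z] is_pole_zero_at_nicely_mero[OF g _ z] by simp
  next
    case False
    then have lim: "f \<midarrow>z\<rightarrow> f z" "g \<midarrow>z\<rightarrow> g z"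
      using f g z pole by (auto simp: nicely_meromorphic_on_def)
    have "g \<midarrow>z\<rightarrow> f z" using Lim_transform_eventually[OF lim(1) ev] .
    then show ?thesis using lim(2) LIM_unique by blast
  qed
qed

theorem theorem4:
  fixes \<alpha> \<rho> :: real and z :: complex
  assumes "\<alpha> > 0" and "0 < \<rho>" and "\<rho> < 1"
    and "z \<noteq> 0" and "\<bar>Arg z\<bar> < pi"
  shows "wh_phi z \<alpha> \<rho> =
    (2 * of_real pi * csqrt z) powr (- of_real (\<alpha> * \<rho>)) *
    (barnes_G (1/2 + of_real \<alpha> / 2 * (1 + of_real \<rho> + ln z / (of_real pi * \<i>))) (of_real \<alpha>) /
     barnes_G (1/2 + of_real \<alpha> / 2 * (1 - of_real \<rho> + ln z / (of_real pi * \<i>))) (of_real \<alpha>)) *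
    (barnes_G (1/2 + of_real \<alpha> / 2 * (1 + of_real \<rho> - ln z / (of_real pi * \<i>))) (of_real \<alpha>) /
     barnes_G (1/2 + of_real \<alpha> / 2 * (1 - of_real \<rho> - ln z / (of_real pi * \<i>))) (of_real \<alpha>))"
proof -
  let ?D = "- \<real>\<^sub>\<le>\<^sub>0 :: complex set"
  let ?P = "\<lambda>f. f nicely_meromorphic_on ?D \<and> (\<forall>x>0. f (of_real x) = wh_phi_pos x \<alpha> \<rho>)"
  define f where "f = (SOME f. ?P f)"
  have closed: "?P (wh_closed_form \<alpha> \<rho>)"
    using nicely_meromorphic_wh_closed_form wh_phi_pos_eq_closed_form assms(1-3) by simp
  then have f: "?P f" unfolding f_def by (rule someI[of ?P])
  have freq: "frequently (\<lambda>z. f z = wh_closed_form \<alpha> \<rho> z) (at 1)"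
    unfolding frequently_def eventually_at
  proof safe
    fix d :: real assume d: "d > 0" "\<forall>z\<in>UNIV. z \<noteq> 1 \<and> dist z 1 < d \<longrightarrow> f z \<noteq> wh_closed_form \<alpha> \<rho> z"
    have "dist (complex_of_real (1 + d / 2)) 1 < d" using d(1) by (simp add: dist_norm norm_divide)
    moreover have "complex_of_real (1 + d / 2) \<noteq> 1" using d(1) by (simp add: complex_eq_iff)
    moreover have "1 + d / 2 > 0" using d(1) by simp
    then have "f (of_real (1 + d / 2)) = wh_closed_form \<alpha> \<rho> (of_real (1 + d / 2))"
      using f closed by metis
    ultimately show False using d(2) by blast
  qed
  have zD: "z \<in> ?D"
  proof
    assume "z \<in> \<real>\<^sub>\<le>\<^sub>0"
    then obtain r where "z = of_real r" "r \<le> 0" by (elim nonpos_Reals_cases)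
    then show False using assms(4,5) Arg_of_real[of r] by auto
  qed
  have "f z = wh_closed_form \<alpha> \<rho> z"
  proof (rule nicely_meromorphic_identity[OF _ _ _ _ _ freq zD])
    show "connected ?D"
    proof -
      have "?D = - (complex_of_real ` {..0})" by (auto elim!: nonpos_Reals_cases)
      then show ?thesis
        using starlike_slotted_complex_plane_left[of 0] by (simp only: starlike_imp_connected)
    qed
  qed (use f closed in \<open>auto simp: closed_nonpos_Reals_complex\<close>)
  then show ?thesis unfolding wh_phi_def f_def wh_closed_form_def .
qed

end
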